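(* Let $\ell>0$ and let $u_->u_+$ be real numbers, with $c=\tfrac12(u_-+u_+)$, so that the function equal to $u_-$ for $x<ct$ and to $u_+$ for $x>ct$ is an (arbitrary) entropy-satisfying simple shock of the inviscid Burgers equation $u_t+uu_x=0$. Then the regularised Burgers equation $$\left[u-\ell^2u_{xx}\right]_t+\left[\tfrac12u^2-\ell^2u\,u_{xx}-\tfrac12\ell^2u_x^2\right]_x=0$$ admits a (weak) weakly singular shock layer solution satisfying $$u(x,t)=c-\eta\!\left(\frac{|x-ct|}{\ell}\right)\operatorname{sgn}(x-ct)\ \to\ \begin{cases}u_-,&x\to-\infty,\\ u_+,&x\to+\infty,\end{cases}$$ where $\eta(z)$, $z\geqslant0$, is determined implicitly, with $u_0=\tfrac12(u_--u_+)$, by $$\int_0^{\eta(z)}\left(\frac{3v}{2u_0+v}\right)^{1/2}\frac{\mathrm{d}v}{u_0-v}=z .$$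
   Context: "Weakly singular shock layer" means a traveling wave that is bounded, continuous, monotone in $x$, and smooth except at $x=ct$, where the derivative becomes infinite. The solution is understood in the weak (distributional) sense; the flux is interpreted as $\tfrac12u^2-\ell^2(uu_x)_x+\tfrac12\ell^2u_x^2$, which is meaningful for bounded continuous $u$ with $u_x\in L^2_{\rm loc}$. *)

theory Defs
  imports "HOL-Analysis.Analysis"
begin

text \<open>Functions of space and time are functions of the pair \<open>(x, t)\<close>.\<close>

text \<open>\<open>Ck_on k S f\<close> is meant for open \<open>S\<close> only: \<open>f\<close> is \<open>k\<close> times continuously differentiable
  on \<open>S\<close>, all derivatives being taken as iterated directional derivatives.\<close>

primrec Ck_on ::
  "nat \<Rightarrow> 'a::real_normed_vector set \<Rightarrow> ('a \<Rightarrow> 'b::real_normed_vector) \<Rightarrow> bool"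
where
  "Ck_on 0 S f \<longleftrightarrow> continuous_on S f"
| "Ck_on (Suc k) S f \<longleftrightarrow>
     (\<forall>p\<in>S. f differentiable (at p)) \<and>
     (\<forall>v. Ck_on k S (\<lambda>p. frechet_derivative f (at p) v))"

definition smooth_on :: "'a::real_normed_vector set \<Rightarrow> ('a \<Rightarrow> 'b::real_normed_vector) \<Rightarrow> bool"
  where "smooth_on S f \<longleftrightarrow> (\<forall>k. Ck_on k S f)"

definition dx :: "(real \<times> real \<Rightarrow> real) \<Rightarrow> real \<times> real \<Rightarrow> real"
  where "dx f p = frechet_derivative f (at p) (1, 0)"

definition dt :: "(real \<times> real \<Rightarrow> real) \<Rightarrow> real \<times> real \<Rightarrow> real"
  where "dt f p = frechet_derivative f (at p) (0, 1)"

definition test_function :: "(real \<times> real \<Rightarrow> real) \<Rightarrow> bool"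
  where "test_function \<phi> \<longleftrightarrow> smooth_on UNIV \<phi> \<and> compact (closure {p. \<phi> p \<noteq> 0})"

definition L2_loc :: "(real \<times> real \<Rightarrow> real) \<Rightarrow> bool"
  where "L2_loc g \<longleftrightarrow> g \<in> borel_measurable borel \<and>
    (\<forall>K. compact K \<longrightarrow> set_integrable lborel K (\<lambda>p. (g p)\<^sup>2))"

text \<open>Only used for \<open>u\<close> continuous and \<open>g\<close> locally square integrable, so that both integrands
  are integrable.\<close>

definition weak_dx :: "(real \<times> real \<Rightarrow> real) \<Rightarrow> (real \<times> real \<Rightarrow> real) \<Rightarrow> bool"
  where "weak_dx u g \<longleftrightarrow> (\<forall>\<phi>. test_function \<phi> \<longrightarrow>
    (\<integral>p. u p * dx \<phi> p \<partial>lborel) = - (\<integral>p. g p * \<phi> p \<partial>lborel))"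

text \<open>Weak solutions of the regularised Burgers equation
    \<open>[u - l\<^sup>2 u\<^sub>x\<^sub>x]\<^sub>t + [u\<^sup>2/2 - l\<^sup>2 (u u\<^sub>x)\<^sub>x + l\<^sup>2 u\<^sub>x\<^sup>2/2]\<^sub>x = 0\<close>
  in the sense of distributions on the whole \<open>(x, t)\<close> plane: all outer derivatives are moved to
  the test function, an odd number of them changing the sign. Here \<open>g\<close> is the weak derivative
  \<open>u\<^sub>x\<close>, unique up to null sets.\<close>

definition rB_weak_solution :: "real \<Rightarrow> (real \<times> real \<Rightarrow> real) \<Rightarrow> bool"
  where "rB_weak_solution l u \<longleftrightarrow>
    bounded (range u) \<and> continuous_on UNIV u \<and>
    (\<exists>g. L2_loc g \<and> weak_dx u g \<and>
      (\<forall>\<phi>. test_function \<phi> \<longrightarrow>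
        (\<integral>p. - u p * dt \<phi> p + l\<^sup>2 * u p * dt (dx (dx \<phi>)) p
              - 1/2 * (u p)\<^sup>2 * dx \<phi> p
              - l\<^sup>2 * (u p * g p) * dx (dx \<phi>) p
              - 1/2 * l\<^sup>2 * (g p)\<^sup>2 * dx \<phi> p \<partial>lborel) = 0))"

text \<open>In the last clause \<open>dx u\<close> is evaluated at \<open>x \<noteq> c t\<close> only, where it is a classical
  derivative.\<close>

definition weakly_singular_shock_layer :: "real \<Rightarrow> (real \<times> real \<Rightarrow> real) \<Rightarrow> bool"
  where "weakly_singular_shock_layer c u \<longleftrightarrow>
    (\<exists>w. \<forall>x t. u (x, t) = w (x - c * t)) \<and>
    bounded (range u) \<and>
    continuous_on UNIV u \<and>
    ((\<forall>t. mono (\<lambda>x. u (x, t))) \<or> (\<forall>t. antimono (\<lambda>x. u (x, t)))) \<and>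
    smooth_on {(x, t). x \<noteq> c * t} u \<and>
    (\<forall>t. filterlim (\<lambda>x. \<bar>dx u (x, t)\<bar>) at_top (at (c * t)))"

definition simple_shock :: "real \<Rightarrow> real \<Rightarrow> real \<Rightarrow> real \<times> real \<Rightarrow> real"
  where "simple_shock um up c = (\<lambda>(x, t). if x < c * t then um else up)"

text \<open>Bounded weak solutions of \<open>u\<^sub>t + (u\<^sup>2/2)\<^sub>x = 0\<close> that satisfy the Kruzhkov entropy
  inequalities, i.e. \<open>E(u)\<^sub>t + Q(u)\<^sub>x \<le> 0\<close> in the sense of distributions for all the entropies
  \<open>E(v) = \<bar>v - k\<bar>\<close>.\<close>

definition burgers_entropy_solution :: "(real \<times> real \<Rightarrow> real) \<Rightarrow> bool"
  where "burgers_entropy_solution u \<longleftrightarrow>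
    u \<in> borel_measurable borel \<and> bounded (range u) \<and>
    (\<forall>\<phi>. test_function \<phi> \<longrightarrow>
      (\<integral>p. u p * dt \<phi> p + 1/2 * (u p)\<^sup>2 * dx \<phi> p \<partial>lborel) = 0) \<and>
    (\<forall>k \<phi>. test_function \<phi> \<and> (\<forall>p. 0 \<le> \<phi> p) \<longrightarrow>
      0 \<le> (\<integral>p. \<bar>u p - k\<bar> * dt \<phi> p
                + sgn (u p - k) * (1/2 * (u p)\<^sup>2 - 1/2 * k\<^sup>2) * dx \<phi> p \<partial>lborel))"

text \<open>The implicit relation between \<open>z\<close> and \<open>y = \<eta>(z)\<close>. The integrand is real on \<open>[0, u0)\<close> and
  not integrable up to \<open>u0\<close>, so \<open>y\<close> ranges over \<open>[0, u0)\<close>; the lower bound also rules out the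
  empty interval.\<close>

definition profile_relation :: "real \<Rightarrow> real \<Rightarrow> real \<Rightarrow> bool"
  where "profile_relation u0 z y \<longleftrightarrow> 0 \<le> y \<and> y < u0 \<and>
    ((\<lambda>v. sqrt (3 * v / (2 * u0 + v)) * (1 / (u0 - v))) has_integral z) {0..y}"

end

theory Submission imports Defs "HOL-Real_Asymp.Real_Asymp" begin

text \<open>
  In the coordinate \<open>\<xi> = x - c t\<close> the operator \<open>\<partial>\<^sub>t + c \<partial>\<^sub>x\<close> annihilates every profile, so with
  \<open>u = c + w (x - c t)\<close> and \<open>g = w'\<close> the weak equation reduces to the ODE
  \<open>(w g)' = g\<^sup>2/2 + (w\<^sup>2 - u0\<^sup>2) / (2 l\<^sup>2)\<close>. Since \<open>w g\<close> extends continuously to the singular point, the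
  ODE is only needed for \<open>\<xi> \<noteq> 0\<close>; the fundamental theorem of calculus applied to \<open>w g\<close> also shows that
  \<open>g\<^sup>2\<close> is locally integrable. The implicit relation for \<open>\<eta>\<close> is the first integral
  \<open>\<eta>'\<^sup>2 = (u0 - \<eta>)\<^sup>2 (2 u0 + \<eta>) / (3 \<eta>)\<close> of this ODE. The entropy inequalities for the simple shock
  reduce to the sign of the jump of \<open>Q - c E\<close>.
\<close>

text \<open>The strength of the singularity shapes the proof. Near 0 the first integral reads
  \<open>\<eta>'^2\<close> ~ \<open>2 u0^3 / (3 \<eta>)\<close>, so \<eta> behaves like z^(2/3), its
  slope like z^(-1/3) and its second derivative like z^(-4/3). The slope is therefore locally square
  integrable, but the pointwise second derivative is not even locally integrable. The product
  \<open>w w'\<close> behaves like z^(1/3) and stays continuous, so derivatives are only ever taken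
  of \<open>w\<close> and of this product.

  The constants arise as follows. One integration of the travelling wave equation gives the ODE up
  to an additive constant, which is fixed by \<open>w^2\<close> tending to \<open>u0^2\<close>. For
  \<open>l = 1\<close> and on the branch \<open>w > 0\<close>, multiplication by \<open>2 w'\<close>
  turns the ODE into \<open>(w w'^2)' = (w^2 - u0^2) w'\<close>, hence
  \<open>w w'^2 = w^3 / 3 - u0^2 w + C\<close>. The choice \<open>C = 2 u0^3 / 3\<close> makes the
  right side \<open>(u0 - w)^2 (2 u0 + w) / 3\<close>. Its double zero at \<open>u0\<close> makes
  the integral for \<open>z\<close> diverge there, so that \<open>u0\<close> is approached only at
  infinity.\<close>

section \<open>Integration along travelling coordinates\<close>

text \<open>On each line of constant \<open>t\<close> the shear is a translation, so Tonelli reduces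
  the claim to translation invariance of Lebesgue measure on the real line.\<close>

lemma lborel_distr_shear:
  fixes c :: real
  shows "distr lborel borel (\<lambda>p::real \<times> real. (fst p + c * snd p, snd p)) = lborel"
proof (rule measure_eqI)
  fix A :: "(real \<times> real) set"
  assume "A \<in> sets (distr lborel borel (\<lambda>p. (fst p + c * snd p, snd p)))"
  then have A [measurable]: "A \<in> sets borel" by simp
  have m [measurable]: "(\<lambda>p::real \<times> real. (fst p + c * snd p, snd p)) \<in> borel \<rightarrow>\<^sub>M borel"
    unfolding borel_prod [symmetric] by measurable
  have ind [measurable]: "(indicator A :: real \<times> real \<Rightarrow> ennreal) \<in> borel_measurable (borel \<Otimes>\<^sub>M borel)"
    using A by (simp add: borel_prod)
  have "emeasure (distr lborel borel (\<lambda>p::real \<times> real. (fst p + c * snd p, snd p))) A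
      = (\<integral>\<^sup>+ p. indicator A p \<partial>distr lborel borel (\<lambda>p::real \<times> real. (fst p + c * snd p, snd p)))"
    by simp
  also have "\<dots> = (\<integral>\<^sup>+ p. indicator A (fst p + c * snd p, snd p) \<partial>(lborel \<Otimes>\<^sub>M lborel))"
    by (subst nn_integral_distr) (auto simp: lborel_prod)
  also have "\<dots> = (\<integral>\<^sup>+ t. \<integral>\<^sup>+ x. indicator A (x + c * t, t) \<partial>lborel \<partial>lborel)"
    by (subst lborel_pair.nn_integral_snd [symmetric]) simp_all
  also have "\<dots> = (\<integral>\<^sup>+ t. \<integral>\<^sup>+ x. indicator A (x, t) \<partial>lborel \<partial>lborel)"
  proof (rule nn_integral_cong)
    fix t :: real
    show "(\<integral>\<^sup>+ x. indicator A (x + c * t, t) \<partial>lborel) = (\<integral>\<^sup>+ x. indicator A (x, t) \<partial>lborel)"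
      using nn_integral_real_affine [of "\<lambda>x. indicator A (x, t)" 1 "c * t"]
      by (simp add: add.commute)
  qed
  also have "\<dots> = (\<integral>\<^sup>+ p. indicator A p \<partial>(lborel \<Otimes>\<^sub>M lborel))"
    by (subst lborel_pair.nn_integral_snd [symmetric]) simp_all
  also have "\<dots> = emeasure lborel A"
    by (simp add: lborel_prod)
  finally show "emeasure (distr lborel borel (\<lambda>p. (fst p + c * snd p, snd p))) A = emeasure lborel A" .
qed simp

lemma integral_lborel_shear:
  fixes f :: "real \<times> real \<Rightarrow> real"
  assumes [measurable]: "f \<in> borel_measurable borel"
  shows "(\<integral>p. f p \<partial>lborel) = (\<integral>p. f (fst p + c * snd p, snd p) \<partial>lborel)"
    and "integrable lborel f \<longleftrightarrow> integrable lborel (\<lambda>p. f (fst p + c * snd p, snd p))"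
proof -
  have m [measurable]: "(\<lambda>p::real \<times> real. (fst p + c * snd p, snd p)) \<in> borel \<rightarrow>\<^sub>M borel"
    unfolding borel_prod [symmetric] by measurable
  have m': "(\<lambda>p::real \<times> real. (fst p + c * snd p, snd p)) \<in> lborel \<rightarrow>\<^sub>M borel"
    using m by simp
  show "(\<integral>p. f p \<partial>lborel) = (\<integral>p. f (fst p + c * snd p, snd p) \<partial>lborel)"
    using integral_distr [OF m' assms] by (simp add: lborel_distr_shear)
  show "integrable lborel f \<longleftrightarrow> integrable lborel (\<lambda>p. f (fst p + c * snd p, snd p))"
    using integrable_distr_eq [OF m' assms] by (simp add: lborel_distr_shear)
qed

lemma borel_measurable_fst_real [measurable]: "(fst :: real \<times> real \<Rightarrow> real) \<in> borel_measurable borel"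
  and borel_measurable_snd_real [measurable]: "(snd :: real \<times> real \<Rightarrow> real) \<in> borel_measurable borel"
  unfolding borel_prod [symmetric] by measurable

text \<open>After the shear, \<open>W\<close> depends on the first coordinate alone and
  \<open>\<Theta>\<close> lives in a fixed rectangle, so a product of two functions of one variable
  dominates. The factor \<open>\<Theta>\<close> stands for test functions as well as for indicators
  of compact sets.\<close>

lemma integrable_travelling_mult:
  fixes W :: "real \<Rightarrow> real" and \<Theta> :: "real \<times> real \<Rightarrow> real"
  assumes W [measurable]: "W \<in> borel_measurable borel"
    and loc: "\<And>r. set_integrable lborel {-r..r} W"
    and \<Theta> [measurable]: "\<Theta> \<in> borel_measurable borel"
    and bd: "\<And>p. \<bar>\<Theta> p\<bar> \<le> M"
    and supp: "\<And>x t. \<Theta> (x, t) \<noteq> 0 \<Longrightarrow> \<bar>x\<bar> \<le> R \<and> \<bar>t\<bar> \<le> R"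
  shows "integrable lborel (\<lambda>p. W (fst p - c * snd p) * \<Theta> p)"
proof -
  \<comment> \<open>If \<open>x\<close> and \<open>t\<close> are bounded by \<open>R\<close>, then
    the travelling coordinate \<open>x - c t\<close> is bounded by this \<open>r\<close>.\<close>
  define r where "r = R + \<bar>c\<bar> * R"
  have m [measurable]: "(\<lambda>p::real \<times> real. (fst p + c * snd p, snd p)) \<in> borel \<rightarrow>\<^sub>M borel"
    unfolding borel_prod [symmetric] by measurable
  have "integrable (lborel \<Otimes>\<^sub>M lborel)
      (\<lambda>p. (indicator {-r..r} (fst p) * W (fst p)) * (M * indicator {-R..R} (snd p)))"
  proof (rule lborel_pair.Fubini_integrable)
    have "integrable lborel (\<lambda>x. (indicator {-r..r} x * W x))"
      using loc [of r] by (simp add: set_integrable_def)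
    then have "integrable lborel (\<lambda>x. \<bar>indicator {-r..r} x * W x\<bar> * (\<integral>t. \<bar>M * indicator {-R..R} t\<bar> \<partial>lborel))"
      by (intro integrable_mult_left integrable_abs)
    then show "integrable lborel (\<lambda>x. \<integral>t. norm ((indicator {-r..r} (fst (x, t)) * W (fst (x, t)))
        * (M * indicator {-R..R} (snd (x, t)))) \<partial>lborel)"
      by (simp only: fst_conv snd_conv real_norm_def abs_mult [of "_ * _" "M * _"] integral_mult_right_zero)
    have "integrable lborel (\<lambda>t::real. M * indicator {-R..R} t)"
      by (intro integrable_mult_right integrable_real_indicator emeasure_compact_finite) auto
    then show "AE x in lborel. integrable lborel (\<lambda>t. (indicator {-r..r} (fst (x, t)) * W (fst (x, t)))
        * (M * indicator {-R..R} (snd (x, t))))"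
      by (intro AE_I2) (simp only: fst_conv snd_conv integrable_mult_right)
    show "(\<lambda>p. (indicator {-r..r} (fst p) * W (fst p)) * (M * indicator {-R..R} (snd p)))
      \<in> borel_measurable (lborel \<Otimes>\<^sub>M lborel)"
      by measurable
  qed
  then have "integrable lborel
      (\<lambda>p. (indicator {-r..r} (fst p) * W (fst p)) * (M * indicator {-R..R} (snd p)))"
    by (simp add: lborel_prod)
  then have "integrable lborel (\<lambda>p. W (fst p) * \<Theta> (fst p + c * snd p, snd p))"
  proof (rule Bochner_Integration.integrable_bound)
    show "(\<lambda>p. W (fst p) * \<Theta> (fst p + c * snd p, snd p)) \<in> borel_measurable lborel"
      by measurable
    show "AE p in lborel. norm (W (fst p) * \<Theta> (fst p + c * snd p, snd p))
       \<le> norm ((indicator {-r..r} (fst p) * W (fst p)) * (M * indicator {-R..R} (snd p)))"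
    proof (rule AE_I2)
      fix p :: "real \<times> real"
      obtain x t where p: "p = (x, t)" by (cases p)
      show "norm (W (fst p) * \<Theta> (fst p + c * snd p, snd p))
       \<le> norm ((indicator {-r..r} (fst p) * W (fst p)) * (M * indicator {-R..R} (snd p)))"
      proof (cases "\<Theta> (x + c * t, t) = 0")
        case False
        have 1: "\<bar>x + c * t\<bar> \<le> R" "\<bar>t\<bar> \<le> R" using supp [OF False] by auto
        have "\<bar>c * t\<bar> \<le> \<bar>c\<bar> * R" using 1 by (simp add: abs_mult mult_left_mono)
        then have "\<bar>x\<bar> \<le> r" using 1 unfolding r_def by linarith
        then show ?thesis using 1 bd [of "(x + c * t, t)"]
          by (simp add: p abs_mult abs_le_iff mult_left_mono)
      qed (simp add: p)
    qed
  qed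
  moreover have "(\<lambda>p. W (fst p - c * snd p) * \<Theta> p) \<in> borel_measurable borel"
    by measurable
  ultimately show ?thesis
    using integral_lborel_shear(2) [of "\<lambda>p. W (fst p - c * snd p) * \<Theta> p" c] by simp
qed

text \<open>Integrability of \<open>k'\<close> is not assumed: otherwise its integral is \<open>0\<close> by convention, so that
  the inner integrals of Fubini's theorem need no almost-everywhere argument.\<close>

lemma integral_derivative_nonneg:
  fixes k k' :: "real \<Rightarrow> real"
  assumes cont: "continuous_on UNIV k"
    and der: "\<And>x. x \<noteq> 0 \<Longrightarrow> (k has_real_derivative k' x) (at x)"
    and supp: "\<And>x. \<bar>x\<bar> > r \<Longrightarrow> k' x = 0"
    and le: "k (-r) \<le> k r" and "0 \<le> r"
  shows "0 \<le> (\<integral>x. k' x \<partial>lborel)"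
proof (cases "integrable lborel k'")
  case True
  have "(k' has_integral (k r - k (-r))) {-r..r}"
    using \<open>0 \<le> r\<close> continuous_on_subset [OF cont] der
    by (intro fundamental_theorem_of_calculus_interior_strong [where S = "{0}"])
       (simp_all add: has_real_derivative_iff_has_vector_derivative)
  moreover have "k' x = 0" if "x \<notin> {-r..r}" for x
    using that by (intro supp) auto
  ultimately have "(k' has_integral (k r - k (-r))) UNIV"
    by (intro has_integral_on_superset [of k' _ "{-r..r}" UNIV]) simp_all
  moreover have "(k' has_integral (\<integral>x. k' x \<partial>lborel)) UNIV"
    using True by (rule has_integral_integral_lborel)
  ultimately have "k r - k (-r) = (\<integral>x. k' x \<partial>lborel)"
    by (rule has_integral_unique)
  then show ?thesis using le by simp
qed (simp add: not_integrable_integral_eq)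

text \<open>The preceding inequality applies to both \<open>k\<close> and
  \<open>- k\<close>.\<close>

lemma integral_derivative_eq_0:
  fixes k k' :: "real \<Rightarrow> real"
  assumes cont: "continuous_on UNIV k"
    and der: "\<And>x. x \<noteq> 0 \<Longrightarrow> (k has_real_derivative k' x) (at x)"
    and supp: "\<And>x. \<bar>x\<bar> > r \<Longrightarrow> k' x = 0"
    and eq: "k (-r) = k r" and "0 \<le> r"
  shows "(\<integral>x. k' x \<partial>lborel) = 0"
proof -
  have "0 \<le> (\<integral>x. k' x \<partial>lborel)"
    using eq by (intro integral_derivative_nonneg [OF cont der supp _ \<open>0 \<le> r\<close>]) auto
  moreover have "0 \<le> (\<integral>x. - k' x \<partial>lborel)"
    using eq supp
    by (intro integral_derivative_nonneg [OF continuous_on_minus [OF cont] DERIV_minus [OF der] _ _ \<open>0 \<le> r\<close>]) auto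
  ultimately show ?thesis by simp
qed

section \<open>Test functions and travelling profiles\<close>

lemma smooth_on_frechet_derivative:
  assumes "smooth_on S f"
  shows "smooth_on S (\<lambda>p. frechet_derivative f (at p) v)"
  unfolding smooth_on_def
proof
  fix k
  have "Ck_on (Suc k) S f"
    using assms unfolding smooth_on_def by blast
  then show "Ck_on k S (\<lambda>p. frechet_derivative f (at p) v)"
    by simp
qed

lemma smooth_on_imp_differentiable:
  assumes "smooth_on S f" "p \<in> S"
  shows "f differentiable (at p)"
proof -
  have "Ck_on (Suc 0) S f"
    using assms unfolding smooth_on_def by blast
  then show ?thesis
    using assms by simp
qed

lemma smooth_on_imp_continuous_on:
  assumes "smooth_on S f"
  shows "continuous_on S f"
proof -
  have "Ck_on 0 S f"
    using assms unfolding smooth_on_def by blast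
  then show ?thesis by simp
qed

lemma test_function_differentiable: "test_function \<phi> \<Longrightarrow> \<phi> differentiable (at p)"
  unfolding test_function_def by (blast intro: smooth_on_imp_differentiable)

lemma test_function_continuous: "test_function \<phi> \<Longrightarrow> continuous_on UNIV \<phi>"
  unfolding test_function_def by (blast intro: smooth_on_imp_continuous_on)

lemma test_function_measurable [measurable_dest]:
  "test_function \<phi> \<Longrightarrow> \<phi> \<in> borel_measurable borel"
  by (intro borel_measurable_continuous_onI test_function_continuous)

text \<open>Off the closed support of \<open>\<phi>\<close> the function vanishes on an open set,
  hence so does its derivative: differentiation does not enlarge the support.\<close>

lemma test_function_frechet_derivative:
  assumes "test_function \<phi>"
  shows "test_function (\<lambda>p. frechet_derivative \<phi> (at p) v)"
proof -
  let ?D = "\<lambda>p. frechet_derivative \<phi> (at p) v" and ?K = "closure {p. \<phi> p \<noteq> 0}"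
  have "?D p = 0" if p: "p \<notin> ?K" for p
  proof -
    have "(\<phi> has_derivative (\<lambda>_. 0)) (at p)"
    proof (rule has_derivative_transform_within_open)
      show "((\<lambda>_. 0) has_derivative (\<lambda>_. 0)) (at p)" by simp
      show "open (- ?K)" by (intro open_Compl closed_closure)
      show "p \<in> - ?K" using p by simp
      show "0 = \<phi> q" if "q \<in> - ?K" for q
        using that closure_subset [of "{p. \<phi> p \<noteq> 0}"] by auto
    qed
    then have "frechet_derivative \<phi> (at p) = (\<lambda>_. 0)"
      by (rule frechet_derivative_at [symmetric])
    then show ?thesis by simp
  qed
  then have "{p. ?D p \<noteq> 0} \<subseteq> ?K" by blast
  moreover have "bounded ?K"
    using assms unfolding test_function_def by (simp add: compact_imp_bounded)
  ultimately have "bounded {p. ?D p \<noteq> 0}"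
    using bounded_subset by blast
  then show ?thesis
    using assms smooth_on_frechet_derivative unfolding test_function_def
    by (auto simp: compact_closure)
qed

lemma test_function_dx: "test_function \<phi> \<Longrightarrow> test_function (dx \<phi>)"
  using test_function_frechet_derivative [of \<phi> "(1, 0)"] unfolding dx_def [abs_def] .

lemma test_function_dt: "test_function \<phi> \<Longrightarrow> test_function (dt \<phi>)"
  using test_function_frechet_derivative [of \<phi> "(0, 1)"] unfolding dt_def [abs_def] .

lemma test_function_support:
  assumes "test_function \<phi>"
  shows "\<exists>R\<ge>0. \<forall>x t. \<phi> (x, t) \<noteq> 0 \<longrightarrow> \<bar>x\<bar> \<le> R \<and> \<bar>t\<bar> \<le> R"
proof -
  have "bounded {p. \<phi> p \<noteq> 0}"
    using assms unfolding test_function_def by (simp add: compact_closure)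
  then obtain R where R: "0 < R" "\<forall>p\<in>{p. \<phi> p \<noteq> 0}. norm p \<le> R"
    unfolding bounded_pos by blast
  have "\<bar>x\<bar> \<le> R \<and> \<bar>t\<bar> \<le> R" if "\<phi> (x, t) \<noteq> 0" for x t
    using bspec [OF R(2), of "(x, t)"] that norm_fst_le [of x t] norm_snd_le [of t x] by simp
  then show ?thesis using R(1) by (intro exI [of _ R]) simp
qed

lemma test_function_bounded:
  assumes "test_function \<phi>"
  shows "\<exists>M. \<forall>p. \<bar>\<phi> p\<bar> \<le> M"
proof -
  let ?K = "closure {p. \<phi> p \<noteq> 0}"
  have "compact ?K"
    using assms unfolding test_function_def by blast
  then have "bounded (\<phi> ` ?K)"
    by (intro compact_imp_bounded compact_continuous_image
        continuous_on_subset [OF test_function_continuous [OF assms] subset_UNIV])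
  then obtain M where M: "\<forall>y\<in>\<phi> ` ?K. norm y \<le> M"
    unfolding bounded_iff ..
  have "\<bar>\<phi> p\<bar> \<le> \<bar>M\<bar>" for p
  proof (cases "\<phi> p = 0")
    case False
    then have "p \<in> ?K" using closure_subset by fastforce
    then have "norm (\<phi> p) \<le> M" using M by simp
    then show ?thesis by simp
  qed simp
  then show ?thesis by (intro exI allI)
qed

text \<open>The direction \<open>(c, 1)\<close> gives the transport operator of the travelling
  frame, the direction \<open>(1, 0)\<close> the spatial slices.\<close>

lemma has_real_derivative_along_line:
  assumes "\<phi> differentiable (at (x + a * s, t + b * s))"
  shows "((\<lambda>s. \<phi> (x + a * s, t + b * s)) has_real_derivative
    a * dx \<phi> (x + a * s, t + b * s) + b * dt \<phi> (x + a * s, t + b * s)) (at s)"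
proof -
  let ?p = "(x + a * s, t + b * s)"
  let ?D = "frechet_derivative \<phi> (at ?p)"
  have "((\<lambda>s. (x + a * s, t + b * s)) has_derivative (\<lambda>h. (a * h, b * h))) (at s)"
    by (auto intro!: derivative_eq_intros)
  moreover have "(\<phi> has_derivative ?D) (at ?p)"
    using assms by (simp add: frechet_derivative_works)
  ultimately have "((\<lambda>s. \<phi> (x + a * s, t + b * s)) has_derivative (\<lambda>h. ?D (a * h, b * h))) (at s)"
    by (rule has_derivative_compose)
  moreover have "?D (a * h, b * h) = (a * dx \<phi> ?p + b * dt \<phi> ?p) * h" for h
  proof -
    have lin: "linear ?D" using assms by (rule linear_frechet_derivative)
    have "?D (a * h, b * h) = ?D ((a * h) *\<^sub>R (1, 0) + (b * h) *\<^sub>R (0, 1))"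
      by simp
    also have "\<dots> = (a * h) *\<^sub>R ?D (1, 0) + (b * h) *\<^sub>R ?D (0, 1)"
      by (simp only: linear_add [OF lin] linear_cmul [OF lin])
    finally show ?thesis by (simp add: dx_def dt_def algebra_simps)
  qed
  ultimately show ?thesis
    by (simp add: has_field_derivative_def)
qed

section \<open>Locally integrable profiles paired with test functions\<close>

definition locally_integrable :: "(real \<Rightarrow> real) \<Rightarrow> bool"
  where "locally_integrable W \<longleftrightarrow>
    W \<in> borel_measurable borel \<and> (\<forall>r. set_integrable lborel {-r..r} W)"

lemma locally_integrable_measurable [measurable_dest]:
  "locally_integrable W \<Longrightarrow> W \<in> borel_measurable borel"
  by (simp add: locally_integrable_def)

lemma locally_integrable_continuous:
  assumes "continuous_on UNIV W"
  shows "locally_integrable W"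
proof -
  have "set_integrable lborel {-r..r} W" for r
    unfolding set_integrable_def
    by (rule borel_integrable_compact) (auto intro: continuous_on_subset [OF assms])
  then show ?thesis
    using assms by (simp add: locally_integrable_def borel_measurable_continuous_onI)
qed

lemma locally_integrable_bounded:
  assumes [measurable]: "W \<in> borel_measurable borel" and "\<And>x. \<bar>W x\<bar> \<le> M"
  shows "locally_integrable W"
proof -
  have "set_integrable lborel {-r..r} W" for r
    unfolding set_integrable_def
  proof (rule integrableI_bounded_set [where A = "{-r..r}" and B = M])
    show "emeasure lborel {-r..r} < \<infinity>" using emeasure_compact_finite by blast
  qed (use assms(2) in \<open>auto simp: indicator_def\<close>)
  then show ?thesis by (simp add: locally_integrable_def)
qed

lemma locally_integrable_mult_left:
  "locally_integrable W \<Longrightarrow> locally_integrable (\<lambda>x. a * W x)"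
  by (auto simp: locally_integrable_def)

lemma locally_integrable_bound:
  assumes "locally_integrable W" and [measurable]: "V \<in> borel_measurable borel"
    and "\<And>x. \<bar>V x\<bar> \<le> W x"
  shows "locally_integrable V"
  unfolding locally_integrable_def
proof (intro conjI allI)
  fix r
  have "integrable lborel (\<lambda>x. indicator {-r..r} x *\<^sub>R W x)"
    using assms(1) by (auto simp: locally_integrable_def set_integrable_def)
  then show "set_integrable lborel {-r..r} V"
    unfolding set_integrable_def
  proof (rule Bochner_Integration.integrable_bound)
    have "norm (indicator {-r..r} x *\<^sub>R V x) \<le> norm (indicator {-r..r} x *\<^sub>R W x)" for x
      using assms(3) [of x] by (auto simp: indicator_def)
    then show "AE x in lborel. norm (indicator {-r..r} x *\<^sub>R V x) \<le> norm (indicator {-r..r} x *\<^sub>R W x)"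
      by simp
  qed measurable
qed (rule assms)

lemma locally_integrable_add:
  "locally_integrable V \<Longrightarrow> locally_integrable W \<Longrightarrow> locally_integrable (\<lambda>x. V x + W x)"
  by (auto simp: locally_integrable_def)

lemma integrable_travelling_test:
  assumes W: "locally_integrable W" and \<phi>: "test_function \<phi>"
  shows "integrable lborel (\<lambda>p. W (fst p - c * snd p) * \<phi> p)"
proof -
  obtain M where M: "\<forall>p. \<bar>\<phi> p\<bar> \<le> M"
    using test_function_bounded [OF \<phi>] by blast
  obtain R where R: "0 \<le> R" "\<forall>x t. \<phi> (x, t) \<noteq> 0 \<longrightarrow> \<bar>x\<bar> \<le> R \<and> \<bar>t\<bar> \<le> R"
    using test_function_support [OF \<phi>] by blast
  show ?thesis
    using W test_function_measurable [OF \<phi>]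
    by (intro integrable_travelling_mult [OF _ _ _ M [rule_format] R(2) [rule_format]]) (simp_all add: locally_integrable_def)
qed

text \<open>Both orders of integration serve a purpose: with \<open>t\<close> inside, the transport
  operator becomes a total derivative; with \<open>\<xi>\<close> inside, one can integrate by parts
  in space.\<close>

lemma integral_travelling_iterated:
  fixes h :: "real \<Rightarrow> real \<Rightarrow> real"
  assumes int: "integrable lborel f"
    and h: "\<And>\<xi> t. f (\<xi> + c * t, t) = h \<xi> t"
  shows "(\<integral>p. f p \<partial>lborel) = (\<integral>t. (\<integral>\<xi>. h \<xi> t \<partial>lborel) \<partial>lborel)"
    and "(\<integral>p. f p \<partial>lborel) = (\<integral>\<xi>. (\<integral>t. h \<xi> t \<partial>lborel) \<partial>lborel)"
proof -
  have [measurable]: "f \<in> borel_measurable borel"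
    using int by (simp add: borel_measurable_integrable)
  have eq: "(\<lambda>p. f (fst p + c * snd p, snd p)) = case_prod h"
    by (auto simp: h)
  have int': "integrable (lborel \<Otimes>\<^sub>M lborel) (case_prod h)"
    using int integral_lborel_shear(2) [of f c] by (simp add: eq lborel_prod)
  have "(\<integral>p. f p \<partial>lborel) = (\<integral>p. case_prod h p \<partial>(lborel \<Otimes>\<^sub>M lborel))"
    using integral_lborel_shear(1) [of f c] by (simp add: eq lborel_prod)
  then show "(\<integral>p. f p \<partial>lborel) = (\<integral>t. (\<integral>\<xi>. h \<xi> t \<partial>lborel) \<partial>lborel)"
    and "(\<integral>p. f p \<partial>lborel) = (\<integral>\<xi>. (\<integral>t. h \<xi> t \<partial>lborel) \<partial>lborel)"
    by (simp_all only: lborel_pair.integral_snd [OF int'] lborel_pair.integral_fst [OF int'])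
qed

lemma integrable_travelling_transport:
  assumes "locally_integrable W" "test_function \<phi>"
  shows "integrable lborel (\<lambda>p. W (fst p - c * snd p) * (dt \<phi> p + c * dx \<phi> p))"
proof -
  have "integrable lborel (\<lambda>p. W (fst p - c * snd p) * dt \<phi> p + c * (W (fst p - c * snd p) * dx \<phi> p))"
    by (intro Bochner_Integration.integrable_add integrable_mult_right integrable_travelling_test
        test_function_dt test_function_dx assms)
  then show ?thesis
    by (simp add: algebra_simps)
qed

text \<open>For fixed \<open>\<xi>\<close> the operator is the derivative of \<open>\<phi>\<close>
  along the characteristic \<open>x = \<xi> + c t\<close>, on which \<open>W\<close> is constant.
  Its integral over \<open>t\<close> vanishes because \<open>\<phi>\<close> has bounded
  support.\<close>

lemma integral_travelling_transport:
  assumes W: "locally_integrable W" and \<phi>: "test_function \<phi>"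
  shows "(\<integral>p. W (fst p - c * snd p) * (dt \<phi> p + c * dx \<phi> p) \<partial>lborel) = 0"
proof -
  let ?D = "\<lambda>\<xi> t. dt \<phi> (\<xi> + c * t, t) + c * dx \<phi> (\<xi> + c * t, t)"
  obtain R where R: "0 \<le> R" "\<forall>x t. dt \<phi> (x, t) \<noteq> 0 \<longrightarrow> \<bar>x\<bar> \<le> R \<and> \<bar>t\<bar> \<le> R"
    using test_function_support [OF test_function_dt [OF \<phi>]] by blast
  obtain R' where R': "0 \<le> R'" "\<forall>x t. dx \<phi> (x, t) \<noteq> 0 \<longrightarrow> \<bar>x\<bar> \<le> R' \<and> \<bar>t\<bar> \<le> R'"
    using test_function_support [OF test_function_dx [OF \<phi>]] by blast
  obtain R'' where R'': "0 \<le> R''" "\<forall>x t. \<phi> (x, t) \<noteq> 0 \<longrightarrow> \<bar>x\<bar> \<le> R'' \<and> \<bar>t\<bar> \<le> R''"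
    using test_function_support [OF \<phi>] by blast
  \<comment> \<open>The support bounds are not strict; the added 1 places the endpoints
    \<open>t = r\<close> and \<open>t = -r\<close> themselves outside the support of
    \<open>\<phi>\<close>.\<close>
  define r where "r = R + R' + R'' + 1"
  have inner: "(\<integral>t. ?D \<xi> t \<partial>lborel) = 0" for \<xi>
  proof (rule integral_derivative_eq_0)
    have der: "((\<lambda>t. \<phi> (\<xi> + c * t, t)) has_real_derivative ?D \<xi> t) (at t)" for t
      using has_real_derivative_along_line [of \<phi> \<xi> c t 0 1] test_function_differentiable [OF \<phi>]
      by (simp add: add.commute)
    show "continuous_on UNIV (\<lambda>t. \<phi> (\<xi> + c * t, t))"
      by (intro continuous_at_imp_continuous_on ballI DERIV_isCont [OF der])
    show "((\<lambda>t. \<phi> (\<xi> + c * t, t)) has_real_derivative ?D \<xi> t) (at t)" for t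
      by (rule der)
    show "?D \<xi> t = 0" if "\<bar>t\<bar> > r" for t
      using R(2) [rule_format, of "\<xi> + c * t" t] R'(2) [rule_format, of "\<xi> + c * t" t] R(1) R'(1) R''(1) that
      unfolding r_def by force
    have "\<phi> (\<xi> + c * t, t) = 0" if "\<bar>t\<bar> = r" for t
      using R''(2) [rule_format, of "\<xi> + c * t" t] R(1) R'(1) R''(1) that unfolding r_def by force
    then show "\<phi> (\<xi> + c * (-r), -r) = \<phi> (\<xi> + c * r, r)"
      using R(1) R'(1) R''(1) unfolding r_def by simp
    show "0 \<le> r" using R(1) R'(1) R''(1) unfolding r_def by simp
  qed
  show ?thesis
    by (subst integral_travelling_iterated(2) [OF integrable_travelling_transport [OF W \<phi>], where c = c and h = "\<lambda>\<xi> t. W \<xi> * ?D \<xi> t"])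
      (simp_all add: inner)
qed

lemma has_real_derivative_test_slice:
  assumes "test_function \<phi>"
  shows "((\<lambda>\<xi>. \<phi> (\<xi> + s, t)) has_real_derivative dx \<phi> (\<xi> + s, t)) (at \<xi>)"
  using has_real_derivative_along_line [of \<phi> s 1 \<xi> t 0] test_function_differentiable [OF assms]
  by (simp add: add.commute)

lemma continuous_on_test_slice:
  assumes "test_function \<phi>"
  shows "continuous_on UNIV (\<lambda>\<xi>. \<phi> (\<xi> + s, t))"
  by (intro continuous_at_imp_continuous_on ballI DERIV_isCont [OF has_real_derivative_test_slice [OF assms]])

lemma test_slice_support:
  assumes \<phi>: "test_function \<phi>"
  shows "\<exists>r\<ge>0. \<forall>\<xi>. r \<le> \<bar>\<xi>\<bar> \<longrightarrow> \<phi> (\<xi> + s, t) = 0 \<and> dx \<phi> (\<xi> + s, t) = 0"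
proof -
  obtain R where R: "0 \<le> R" "\<forall>x t. \<phi> (x, t) \<noteq> 0 \<longrightarrow> \<bar>x\<bar> \<le> R \<and> \<bar>t\<bar> \<le> R"
    using test_function_support [OF \<phi>] by blast
  obtain R' where R': "0 \<le> R'" "\<forall>x t. dx \<phi> (x, t) \<noteq> 0 \<longrightarrow> \<bar>x\<bar> \<le> R' \<and> \<bar>t\<bar> \<le> R'"
    using test_function_support [OF test_function_dx [OF \<phi>]] by blast
  \<comment> \<open>The term \<open>\<bar>s\<bar>\<close> compensates the shift of the slice, and
    the 1 again puts the endpoints strictly outside the support.\<close>
  have "\<phi> (\<xi> + s, t) = 0 \<and> dx \<phi> (\<xi> + s, t) = 0" if "R + R' + \<bar>s\<bar> + 1 \<le> \<bar>\<xi>\<bar>" for \<xi>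
    using R(2) [rule_format, of "\<xi> + s" t] R'(2) [rule_format, of "\<xi> + s" t] R(1) R'(1) that
    by linarith
  then show ?thesis
    using R(1) R'(1) by (intro exI [of _ "R + R' + \<bar>s\<bar> + 1"]) simp
qed

text \<open>On each slice \<open>A \<phi>\<close> is a primitive of the sum of the two integrands
  off 0. Its continuity at 0 excludes a jump, so the distributional derivative of the travelling
  \<open>A\<close> carries no singular part there. The lemma yields both the weak derivative of
  \<open>u\<close> and the weak form of the ODE.\<close>

lemma integral_travelling_by_parts:
  assumes A: "continuous_on UNIV A"
    and der: "\<And>\<xi>. \<xi> \<noteq> 0 \<Longrightarrow> (A has_real_derivative a \<xi>) (at \<xi>)"
    and a: "locally_integrable a" and \<phi>: "test_function \<phi>"
  shows "(\<integral>p. A (fst p - c * snd p) * dx \<phi> p \<partial>lborel) = - (\<integral>p. a (fst p - c * snd p) * \<phi> p \<partial>lborel)"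
proof -
  let ?k = "\<lambda>t \<xi>. A \<xi> * dx \<phi> (\<xi> + c * t, t) + a \<xi> * \<phi> (\<xi> + c * t, t)"
  have inner: "(\<integral>\<xi>. ?k t \<xi> \<partial>lborel) = 0" for t
  proof -
    obtain r where r: "0 \<le> r"
        "\<forall>\<xi>. r \<le> \<bar>\<xi>\<bar> \<longrightarrow> \<phi> (\<xi> + c * t, t) = 0 \<and> dx \<phi> (\<xi> + c * t, t) = 0"
      using test_slice_support [OF \<phi>, of "c * t" t] by blast
    show ?thesis
    proof (rule integral_derivative_eq_0)
      show "continuous_on UNIV (\<lambda>\<xi>. A \<xi> * \<phi> (\<xi> + c * t, t))"
        by (intro continuous_on_mult A continuous_on_test_slice \<phi>)
      show "((\<lambda>\<xi>. A \<xi> * \<phi> (\<xi> + c * t, t)) has_real_derivative ?k t \<xi>) (at \<xi>)" if "\<xi> \<noteq> 0" for \<xi>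
        using DERIV_mult [OF der [OF that] has_real_derivative_test_slice [OF \<phi>, of "c * t" t]]
        by (simp add: algebra_simps)
      show "A (-r) * \<phi> (-r + c * t, t) = A r * \<phi> (r + c * t, t)"
        using r(1) r(2) [rule_format, of r] r(2) [rule_format, of "-r"] by simp
      show "?k t \<xi> = 0" if "r < \<bar>\<xi>\<bar>" for \<xi>
        using r(2) [rule_format, of \<xi>] that by simp
    qed (rule r(1))
  qed
  have i1: "integrable lborel (\<lambda>p. A (fst p - c * snd p) * dx \<phi> p)"
    by (intro integrable_travelling_test locally_integrable_continuous A test_function_dx \<phi>)
  have i2: "integrable lborel (\<lambda>p. a (fst p - c * snd p) * \<phi> p)"
    by (intro integrable_travelling_test a \<phi>)
  have "(\<integral>p. A (fst p - c * snd p) * dx \<phi> p + a (fst p - c * snd p) * \<phi> p \<partial>lborel) = 0"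
    by (subst integral_travelling_iterated(1) [OF Bochner_Integration.integrable_add [OF i1 i2], where c = c and h = "\<lambda>\<xi> t. ?k t \<xi>"])
      (simp_all add: inner)
  then show ?thesis
    using i1 i2 by simp
qed

text \<open>On the slice at time \<open>t\<close> the integral is
  \<open>(a - b) \<phi> (c t, t)\<close>: a downward jump has a nonpositive distributional
  derivative.\<close>

lemma integral_travelling_step_nonneg:
  assumes "b \<le> a" and \<phi>: "test_function \<phi>" and nonneg: "\<And>p. 0 \<le> \<phi> p"
  shows "0 \<le> (\<integral>p. (if fst p - c * snd p < 0 then a else b) * dx \<phi> p \<partial>lborel)"
proof -
  let ?V = "\<lambda>\<xi>::real. if \<xi> < 0 then a else b"
  have V: "locally_integrable ?V"
    by (rule locally_integrable_bounded [where M = "max \<bar>a\<bar> \<bar>b\<bar>"]) auto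
  have inner: "0 \<le> (\<integral>\<xi>. ?V \<xi> * dx \<phi> (\<xi> + c * t, t) \<partial>lborel)" for t
  proof -
    let ?\<phi> = "\<lambda>\<xi>. \<phi> (\<xi> + c * t, t)"
    obtain r where r: "0 \<le> r"
        "\<forall>\<xi>. r \<le> \<bar>\<xi>\<bar> \<longrightarrow> \<phi> (\<xi> + c * t, t) = 0 \<and> dx \<phi> (\<xi> + c * t, t) = 0"
      using test_slice_support [OF \<phi>, of "c * t" t] by blast
    \<comment> \<open>A continuous primitive of the discontinuous integrand: \<open>min\<close> and
      \<open>max\<close> freeze the inactive branch at its value at the jump, so that the increment
      from \<open>-r\<close> to \<open>r\<close> is exactly
      \<open>(a - b) * ?\<phi> 0\<close>.\<close>
    let ?k = "\<lambda>\<xi>. a * ?\<phi> (min \<xi> 0) + b * ?\<phi> (max \<xi> 0)"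
    show ?thesis
    proof (rule integral_derivative_nonneg)
      show "continuous_on UNIV ?k"
      proof -
        have "continuous_on UNIV (\<lambda>\<xi>. ?\<phi> (min \<xi> 0))" "continuous_on UNIV (\<lambda>\<xi>. ?\<phi> (max \<xi> 0))"
          using continuous_on_test_slice [OF \<phi>, of "c * t" t]
          by (rule continuous_on_compose2; simp add: continuous_on_min continuous_on_max)+
        then show ?thesis
          by (intro continuous_on_add continuous_on_mult continuous_on_const)
      qed
      show "(?k has_real_derivative ?V \<xi> * dx \<phi> (\<xi> + c * t, t)) (at \<xi>)" if "\<xi> \<noteq> 0" for \<xi>
      proof (cases "\<xi> < 0")
        case True
        have "((\<lambda>\<xi>. a * ?\<phi> \<xi> + b * ?\<phi> 0) has_real_derivative ?V \<xi> * dx \<phi> (\<xi> + c * t, t)) (at \<xi>)"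
          using True DERIV_add [OF DERIV_cmult [OF has_real_derivative_test_slice [OF \<phi>, of "c * t" t \<xi>], of a]
              DERIV_const [of "b * ?\<phi> 0"]]
          by simp
        then show ?thesis
          by (rule has_field_derivative_transform_within_open [where S = "{..<0}"])
            (use True in auto)
      next
        case False
        have "((\<lambda>\<xi>. a * ?\<phi> 0 + b * ?\<phi> \<xi>) has_real_derivative ?V \<xi> * dx \<phi> (\<xi> + c * t, t)) (at \<xi>)"
          using False DERIV_add [OF DERIV_const [of "a * ?\<phi> 0"]
              DERIV_cmult [OF has_real_derivative_test_slice [OF \<phi>, of "c * t" t \<xi>], of b]]
          by simp
        then show ?thesis
          by (rule has_field_derivative_transform_within_open [where S = "{0<..}"])
            (use False that in auto)
      qed
      have "b * ?\<phi> 0 \<le> a * ?\<phi> 0" using assms by (intro mult_right_mono) auto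
      then show "?k (-r) \<le> ?k r"
        using r(1) r(2) [rule_format, of r] r(2) [rule_format, of "-r"] by (simp add: min_def max_def)
      show "?V \<xi> * dx \<phi> (\<xi> + c * t, t) = 0" if "r < \<bar>\<xi>\<bar>" for \<xi>
        using r(2) [rule_format, of \<xi>] that by simp
    qed (rule r(1))
  qed
  have int: "integrable lborel (\<lambda>p. ?V (fst p - c * snd p) * dx \<phi> p)"
    by (rule integrable_travelling_test [OF V test_function_dx [OF \<phi>]])
  show ?thesis
    by (subst integral_travelling_iterated(1) [OF int, where c = c and h = "\<lambda>\<xi> t. ?V \<xi> * dx \<phi> (\<xi> + c * t, t)"])
      (simp_all add: inner)
qed

lemma integral_dx_test_function:
  assumes "test_function \<phi>"
  shows "(\<integral>p. dx \<phi> p \<partial>lborel) = 0"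
  using integral_travelling_by_parts [of "\<lambda>_. 1" "\<lambda>_. 0" \<phi> 0] assms
  by (simp add: locally_integrable_continuous)

text \<open>Adding and subtracting \<open>c U dx \<phi>\<close> splits off a transport term of
  integral 0. What remains is the flux relative to the moving frame, the quantity in the
  Rankine-Hugoniot condition.\<close>

lemma integral_travelling_flux:
  assumes U: "locally_integrable U" and F: "locally_integrable F" and \<phi>: "test_function \<phi>"
  shows "(\<integral>p. U (fst p - c * snd p) * dt \<phi> p + F (fst p - c * snd p) * dx \<phi> p \<partial>lborel)
    = (\<integral>p. (F (fst p - c * snd p) - c * U (fst p - c * snd p)) * dx \<phi> p \<partial>lborel)"
proof -
  let ?V = "\<lambda>\<xi>. F \<xi> + (- c) * U \<xi>"
  have V: "locally_integrable ?V"
    by (intro locally_integrable_add locally_integrable_mult_left U F)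
  have "(\<integral>p. U (fst p - c * snd p) * dt \<phi> p + F (fst p - c * snd p) * dx \<phi> p \<partial>lborel)
      = (\<integral>p. U (fst p - c * snd p) * (dt \<phi> p + c * dx \<phi> p) + ?V (fst p - c * snd p) * dx \<phi> p \<partial>lborel)"
    by (simp add: algebra_simps)
  also have "\<dots> = (\<integral>p. ?V (fst p - c * snd p) * dx \<phi> p \<partial>lborel)"
    by (subst Bochner_Integration.integral_add [OF integrable_travelling_transport [OF U \<phi>]
          integrable_travelling_test [OF V test_function_dx [OF \<phi>]]])
      (simp only: integral_travelling_transport [OF U \<phi>] add_0_left)
  finally show ?thesis by simp
qed

section \<open>The entropy shock\<close>

text \<open>The relative entropy flux factors as
  \<open>\<bar>v - k\<bar> * (v + k - 2 * c) / 2\<close>, and \<open>2 c = um + up\<close> exchanges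
  the two states in the second factor. For \<open>k\<close> outside the interval from
  \<open>up\<close> to \<open>um\<close> the two sides agree; for \<open>k\<close> inside it they
  have opposite signs, and entropy is dissipated.\<close>

lemma entropy_flux_jump:
  fixes um up k :: real
  assumes "up \<le> um" "c = 1/2 * (um + up)"
  shows "sgn (up - k) * (1/2 * up\<^sup>2 - 1/2 * k\<^sup>2) - c * \<bar>up - k\<bar>
    \<le> sgn (um - k) * (1/2 * um\<^sup>2 - 1/2 * k\<^sup>2) - c * \<bar>um - k\<bar>"
proof -
  have eq: "sgn (v - k) * (1/2 * v\<^sup>2 - 1/2 * k\<^sup>2) - c * \<bar>v - k\<bar> = \<bar>v - k\<bar> * (v + k - 2 * c) / 2" for v
    by (simp add: sgn_if abs_if power2_eq_square field_simps)
  consider "um \<le> k" | "k \<le> up" | "up \<le> k" "k \<le> um" by linarith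
  then have "\<bar>up - k\<bar> * (k - um) \<le> \<bar>um - k\<bar> * (k - up)"
  proof cases
    case 3
    then have "\<bar>up - k\<bar> * (k - um) \<le> 0" "0 \<le> \<bar>um - k\<bar> * (k - up)"
      by (auto intro: mult_nonneg_nonpos)
    then show ?thesis by linarith
  qed (use assms in \<open>auto simp: abs_if algebra_simps\<close>)
  moreover have "up + k - 2 * c = k - um" "um + k - 2 * c = k - up"
    using assms(2) by simp_all
  ultimately show ?thesis
    unfolding eq by (simp only: divide_right_mono zero_le_numeral)
qed

lemma burgers_entropy_solution_simple_shock:
  assumes "up \<le> um" and c: "c = 1/2 * (um + up)"
  shows "burgers_entropy_solution (simple_shock um up c)"
proof -
  let ?U = "\<lambda>\<xi>::real. if \<xi> < 0 then um else up"
  have S: "simple_shock um up c p = ?U (fst p - c * snd p)" for p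
    by (cases p) (auto simp: simple_shock_def)
  have li: "locally_integrable (\<lambda>\<xi>. f (?U \<xi>))" for f :: "real \<Rightarrow> real"
  proof (rule locally_integrable_bounded)
    have "(\<lambda>\<xi>. f (?U \<xi>)) = (\<lambda>\<xi>. if \<xi> < 0 then f um else f up)" by auto
    then show "(\<lambda>\<xi>. f (?U \<xi>)) \<in> borel_measurable borel" by simp
    show "\<bar>f (?U \<xi>)\<bar> \<le> max \<bar>f um\<bar> \<bar>f up\<bar>" for \<xi> by auto
  qed
  have meas: "simple_shock um up c \<in> borel_measurable borel"
    unfolding S [abs_def] by measurable
  have bdd: "bounded (range (simple_shock um up c))"
    by (rule bounded_subset [of "{um, up}"]) (auto simp: S)
  have weak: "(\<integral>p. simple_shock um up c p * dt \<phi> p + 1/2 * (simple_shock um up c p)\<^sup>2 * dx \<phi> p \<partial>lborel) = 0"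
    if \<phi>: "test_function \<phi>" for \<phi>
  proof -
    \<comment> \<open>Rankine-Hugoniot: with the mean speed \<open>c\<close>, the relative flux has
      the same value at both states, and a constant integrates to 0 against
      \<open>dx \<phi>\<close>.\<close>
    have k: "1/2 * (?U \<xi>)\<^sup>2 - c * ?U \<xi> = - (um * up) / 2" for \<xi>
      by (simp add: c power2_eq_square field_simps)
    have "(\<integral>p. - (um * up) / 2 * dx \<phi> p \<partial>lborel) = 0"
      by (simp only: integral_mult_right_zero integral_dx_test_function [OF \<phi>] mult_zero_right)
    then show ?thesis
      unfolding S
      by (subst integral_travelling_flux [OF li [of "\<lambda>v. v"] li [of "\<lambda>v. 1/2 * v\<^sup>2"] \<phi>]) (simp only: k)
  qed
  have entropy: "0 \<le> (\<integral>p. \<bar>simple_shock um up c p - k\<bar> * dt \<phi> p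
      + sgn (simple_shock um up c p - k) * (1/2 * (simple_shock um up c p)\<^sup>2 - 1/2 * k\<^sup>2) * dx \<phi> p \<partial>lborel)"
    if \<phi>: "test_function \<phi>" and nonneg: "\<And>p. 0 \<le> \<phi> p" for k \<phi>
  proof -
    let ?Q = "\<lambda>v. sgn (v - k) * (1/2 * v\<^sup>2 - 1/2 * k\<^sup>2)"
    let ?q = "\<lambda>v. ?Q v - c * \<bar>v - k\<bar>"
    have "0 \<le> (\<integral>p. (if fst p - c * snd p < 0 then ?q um else ?q up) * dx \<phi> p \<partial>lborel)"
      by (rule integral_travelling_step_nonneg [OF entropy_flux_jump [OF assms] \<phi> nonneg])
    also have "(\<lambda>p. (if fst p - c * snd p < 0 then ?q um else ?q up)) = (\<lambda>p. ?q (?U (fst p - c * snd p)))"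
      by auto
    finally show ?thesis
      unfolding S
      by (subst integral_travelling_flux [OF li [of "\<lambda>v. \<bar>v - k\<bar>"] li [of ?Q] \<phi>])
  qed
  show ?thesis
    unfolding burgers_entropy_solution_def using meas bdd weak entropy by blast
qed

section \<open>Weak travelling waves of the regularised equation\<close>

text \<open>As \<open>f\<close> may be unbounded near 0, the fundamental theorem with one
  exceptional point gives only a gauge integral. The sign of \<open>f\<close> makes that integral
  absolute, hence a Lebesgue integral. The case of interest is \<open>f = g^2 / 2\<close>, with the
  bounded part of the ODE in \<open>h\<close>.\<close>

lemma locally_integrable_derivative_nonneg:
  assumes cont: "continuous_on UNIV F"
    and der: "\<And>\<xi>. \<xi> \<noteq> 0 \<Longrightarrow> (F has_real_derivative f \<xi> + h \<xi>) (at \<xi>)"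
    and h: "continuous_on UNIV h" and f: "f \<in> borel_measurable borel" and nonneg: "\<And>\<xi>. 0 \<le> f \<xi>"
  shows "locally_integrable f"
proof -
  have "set_integrable lborel {-r..r} f" for r :: real
  proof (cases "0 \<le> r")
    case True
    have "((\<lambda>\<xi>. f \<xi> + h \<xi>) has_integral (F r - F (-r))) {-r..r}"
      using True continuous_on_subset [OF cont] der
      by (intro fundamental_theorem_of_calculus_interior_strong [where S = "{0}"])
        (simp_all add: has_real_derivative_iff_has_vector_derivative)
    moreover have "h integrable_on {-r..r}"
      by (intro integrable_continuous_real continuous_on_subset [OF h subset_UNIV])
    ultimately have "(\<lambda>\<xi>. (f \<xi> + h \<xi>) - h \<xi>) integrable_on {-r..r}"
      by (intro integrable_diff) (rule has_integral_integrable)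
    then have "f absolutely_integrable_on {-r..r}"
      using nonneg by (intro nonnegative_absolutely_integrable_1) simp_all
    then have "integrable (completion lborel) (\<lambda>\<xi>. indicator {-r..r} \<xi> *\<^sub>R f \<xi>)"
      by (simp add: set_integrable_def)
    moreover have "(\<lambda>\<xi>. indicator {-r..r} \<xi> *\<^sub>R f \<xi>) \<in> borel_measurable lborel"
      using f by measurable
    ultimately show ?thesis
      unfolding set_integrable_def by (simp only: integrable_completion)
  qed (simp add: set_integrable_def)
  then show ?thesis using f by (simp add: locally_integrable_def)
qed

lemma rB_weak_solution_travelling:
  fixes w g :: "real \<Rightarrow> real"
  assumes l: "l \<noteq> 0"
    and w: "continuous_on UNIV w" and bdd: "bounded (range w)"
    and der: "\<And>\<xi>. \<xi> \<noteq> 0 \<Longrightarrow> (w has_real_derivative g \<xi>) (at \<xi>)"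
    and g: "g \<in> borel_measurable borel"
    and F: "continuous_on UNIV (\<lambda>\<xi>. w \<xi> * g \<xi>)"
    and ode: "\<And>\<xi>. \<xi> \<noteq> 0 \<Longrightarrow>
      ((\<lambda>\<xi>. w \<xi> * g \<xi>) has_real_derivative 1/2 * (g \<xi>)\<^sup>2 + ((w \<xi>)\<^sup>2 / (2 * l\<^sup>2) - K)) (at \<xi>)"
  shows "rB_weak_solution l (\<lambda>p. c + w (fst p - c * snd p))"
proof -
  let ?\<xi> = "\<lambda>p::real \<times> real. fst p - c * snd p"
  have [measurable]: "?\<xi> \<in> borel_measurable borel" by measurable
  note [measurable] = g
  have w2: "continuous_on UNIV (\<lambda>\<xi>. (w \<xi>)\<^sup>2)"
    by (intro continuous_on_power w)
  have cw: "continuous_on UNIV (\<lambda>\<xi>. c + w \<xi>)"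
    by (intro continuous_on_add continuous_on_const w)
  have "locally_integrable (\<lambda>\<xi>. 1/2 * (g \<xi>)\<^sup>2)"
    by (rule locally_integrable_derivative_nonneg [OF F ode])
      (auto intro!: continuous_on_diff continuous_on_divide continuous_on_const w2 simp: l)
  then have g2: "locally_integrable (\<lambda>\<xi>. (g \<xi>)\<^sup>2)"
    using locally_integrable_mult_left [of "\<lambda>\<xi>. 1/2 * (g \<xi>)\<^sup>2" 2] by simp
  have li_g: "locally_integrable g"
  proof (rule locally_integrable_bound)
    show "locally_integrable (\<lambda>\<xi>. 1 + (g \<xi>)\<^sup>2)"
      by (intro locally_integrable_add g2 locally_integrable_continuous continuous_on_const)
    show "\<bar>g \<xi>\<bar> \<le> 1 + (g \<xi>)\<^sup>2" for \<xi>
      using zero_le_power2 [of "\<bar>g \<xi>\<bar> - 1"] by (simp add: power2_diff)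
  qed (rule g)
  have li_ode: "locally_integrable (\<lambda>\<xi>. 1/2 * (g \<xi>)\<^sup>2 + ((w \<xi>)\<^sup>2 / (2 * l\<^sup>2) - K))"
    by (intro locally_integrable_add locally_integrable_mult_left g2 locally_integrable_continuous
        continuous_on_diff continuous_on_divide continuous_on_const w2) (simp add: l)
  have L2: "L2_loc (\<lambda>p. g (?\<xi> p))"
    unfolding L2_loc_def
  proof (intro conjI allI impI)
    fix K :: "(real \<times> real) set"
    assume K: "compact K"
    obtain R where R: "\<forall>p\<in>K. norm p \<le> R"
      using compact_imp_bounded [OF K] unfolding bounded_iff ..
    have "integrable lborel (\<lambda>p. (g (?\<xi> p))\<^sup>2 * indicator K p)"
    proof (rule integrable_travelling_mult)
      show "(indicator K :: _ \<Rightarrow> real) \<in> borel_measurable borel"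
        using K by (intro borel_measurable_indicator borel_closed compact_imp_closed)
      show "\<bar>indicator K p\<bar> \<le> (1::real)" for p by (simp add: indicator_def)
      show "\<bar>x\<bar> \<le> R \<and> \<bar>t\<bar> \<le> R" if "indicator K (x, t) \<noteq> (0::real)" for x t
        using bspec [OF R, of "(x, t)"] that norm_fst_le [of x t] norm_snd_le [of t x]
        by (auto simp: indicator_def split: if_splits)
      show "set_integrable lborel {-r..r} (\<lambda>\<xi>. (g \<xi>)\<^sup>2)" for r
        using g2 by (simp add: locally_integrable_def)
    qed measurable
    then show "set_integrable lborel K (\<lambda>p. (g (?\<xi> p))\<^sup>2)"
      by (simp add: set_integrable_def mult.commute)
  qed measurable
  have cw_der: "((\<lambda>\<xi>. c + w \<xi>) has_real_derivative g \<xi>) (at \<xi>)" if "\<xi> \<noteq> 0" for \<xi>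
    using DERIV_add [OF DERIV_const [of c] der [OF that]] by simp
  have by_parts: "(\<integral>p. (c + w (?\<xi> p)) * dx \<phi> p \<partial>lborel) = - (\<integral>p. g (?\<xi> p) * \<phi> p \<partial>lborel)"
    if "test_function \<phi>" for \<phi>
    by (rule integral_travelling_by_parts [OF cw cw_der li_g that])
  have main: "(\<integral>p. - (c + w (?\<xi> p)) * dt \<phi> p + l\<^sup>2 * (c + w (?\<xi> p)) * dt (dx (dx \<phi>)) p
      - 1/2 * (c + w (?\<xi> p))\<^sup>2 * dx \<phi> p - l\<^sup>2 * ((c + w (?\<xi> p)) * g (?\<xi> p)) * dx (dx \<phi>) p
      - 1/2 * l\<^sup>2 * (g (?\<xi> p))\<^sup>2 * dx \<phi> p \<partial>lborel) = 0" (is "integral\<^sup>L _ ?I = 0")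
    if \<phi>: "test_function \<phi>" for \<phi>
  proof -
    define \<phi>1 where "\<phi>1 = dx \<phi>"
    define \<phi>2 where "\<phi>2 = dx \<phi>1"
    define \<phi>3 where "\<phi>3 = dx \<phi>2"
    have t1: "test_function \<phi>1" and t2: "test_function \<phi>2" and t3: "test_function \<phi>3"
      unfolding \<phi>1_def \<phi>2_def \<phi>3_def by (intro test_function_dx \<phi>)+
    have li: "locally_integrable (\<lambda>\<xi>. c + w \<xi>)" "locally_integrable (\<lambda>\<xi>. w \<xi> * g \<xi>)"
      "locally_integrable (\<lambda>\<xi>. (w \<xi>)\<^sup>2)"
      by (intro locally_integrable_continuous cw F w2)+
    \<comment> \<open>Under this name the eight integrals enter the final computation as
      atoms.\<close>
    define T where "T = (\<lambda>f. \<integral>p. f p \<partial>(lborel :: (real \<times> real) measure) :: real)"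
    let ?f1 = "\<lambda>p. (c + w (?\<xi> p)) * (dt \<phi> p + c * dx \<phi> p)"
    let ?f2 = "\<lambda>p. (c + w (?\<xi> p)) * (dt \<phi>2 p + c * dx \<phi>2 p)"
    let ?f3 = "\<lambda>p. (c + w (?\<xi> p)) * \<phi>3 p"
    let ?f4 = "\<lambda>p. g (?\<xi> p) * \<phi>2 p"
    let ?f5 = "\<lambda>p. (w (?\<xi> p) * g (?\<xi> p)) * \<phi>2 p"
    let ?f6 = "\<lambda>p. (w (?\<xi> p))\<^sup>2 * \<phi>1 p"
    let ?f7 = "\<lambda>p. (g (?\<xi> p))\<^sup>2 * \<phi>1 p"
    have i8: "integrable lborel \<phi>1"
      using integrable_travelling_test [of "\<lambda>_. 1" \<phi>1 0] t1 by (simp add: locally_integrable_continuous)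
    have hb: "has_bochner_integral lborel ?f1 (T ?f1)" "has_bochner_integral lborel ?f2 (T ?f2)"
      "has_bochner_integral lborel ?f3 (T ?f3)" "has_bochner_integral lborel ?f4 (T ?f4)"
      "has_bochner_integral lborel ?f5 (T ?f5)" "has_bochner_integral lborel ?f6 (T ?f6)"
      "has_bochner_integral lborel ?f7 (T ?f7)" "has_bochner_integral lborel \<phi>1 (T \<phi>1)"
      unfolding T_def
      by (rule has_bochner_integral_integrable, rule integrable_travelling_transport [OF li(1) \<phi>])
        (rule has_bochner_integral_integrable, rule integrable_travelling_transport [OF li(1) t2],
         rule has_bochner_integral_integrable, rule integrable_travelling_test [OF li(1) t3],
         rule has_bochner_integral_integrable, rule integrable_travelling_test [OF li_g t2],
         rule has_bochner_integral_integrable, rule integrable_travelling_test [OF li(2) t2],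
         rule has_bochner_integral_integrable, rule integrable_travelling_test [OF li(3) t1],
         rule has_bochner_integral_integrable, rule integrable_travelling_test [OF g2 t1],
         rule has_bochner_integral_integrable, rule i8)
    have T1: "T ?f1 = 0" "T ?f2 = 0" "T \<phi>1 = 0"
      unfolding T_def using integral_travelling_transport [OF li(1) \<phi>] integral_travelling_transport [OF li(1) t2]
        integral_dx_test_function [OF \<phi>] by (simp_all only: \<phi>1_def)
    have T3: "T ?f3 = - T ?f4"
      unfolding T_def \<phi>3_def by (rule by_parts [OF t2])
    have "T ?f5 = - (\<integral>p. (1/2 * (g (?\<xi> p))\<^sup>2 + ((w (?\<xi> p))\<^sup>2 / (2 * l\<^sup>2) - K)) * \<phi>1 p \<partial>lborel)"
      unfolding T_def \<phi>2_def by (rule integral_travelling_by_parts [OF F ode li_ode t1])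
    moreover have "(\<integral>p. 1/2 * ?f7 p + 1 / (2 * l\<^sup>2) * ?f6 p + (- K) * \<phi>1 p \<partial>lborel)
        = 1/2 * T ?f7 + 1 / (2 * l\<^sup>2) * T ?f6 + (- K) * T \<phi>1"
      by (intro has_bochner_integral_integral_eq has_bochner_integral_add has_bochner_integral_mult_right hb)
    moreover have "(\<lambda>p. (1/2 * (g (?\<xi> p))\<^sup>2 + ((w (?\<xi> p))\<^sup>2 / (2 * l\<^sup>2) - K)) * \<phi>1 p)
        = (\<lambda>p. 1/2 * ?f7 p + 1 / (2 * l\<^sup>2) * ?f6 p + (- K) * \<phi>1 p)"
      by (simp add: fun_eq_iff algebra_simps)
    ultimately have T5: "T ?f5 = - (1/2 * T ?f7 + 1 / (2 * l\<^sup>2) * T ?f6)"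
      by (simp add: T1)
    \<comment> \<open>With \<open>u = c + w\<close>, the terms \<open>?f1\<close> and
      \<open>?f2\<close> complete the time derivatives to transport operators; applying the second
      one to \<open>\<phi>2\<close> keeps the order of mixed derivatives given in the definition.
      The completion costs a \<open>?f3\<close> term, which cancels against the \<open>c g\<close>
      part of \<open>u g\<close> in \<open>?f4\<close>, and a term \<open>c u dx \<phi>\<close>,
      which reduces \<open>u^2 / 2\<close> to \<open>w^2 / 2 - c^2 / 2\<close>. The ODE balances
      \<open>?f5\<close>, \<open>?f6\<close> and \<open>?f7\<close>.\<close>
    have I: "?I = (\<lambda>p. (- 1) * ?f1 p + l\<^sup>2 * ?f2 p + (- (l\<^sup>2 * c)) * ?f3 p + (- (l\<^sup>2 * c)) * ?f4 p
        + (- l\<^sup>2) * ?f5 p + (- 1/2) * ?f6 p + (- (l\<^sup>2 / 2)) * ?f7 p + c\<^sup>2 / 2 * \<phi>1 p)"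
      by (simp add: fun_eq_iff \<phi>1_def [symmetric] \<phi>2_def [symmetric] \<phi>3_def [symmetric]
          power2_sum power2_eq_square algebra_simps)
    have "integral\<^sup>L lborel ?I = (- 1) * T ?f1 + l\<^sup>2 * T ?f2 + (- (l\<^sup>2 * c)) * T ?f3 + (- (l\<^sup>2 * c)) * T ?f4
        + (- l\<^sup>2) * T ?f5 + (- 1/2) * T ?f6 + (- (l\<^sup>2 / 2)) * T ?f7 + c\<^sup>2 / 2 * T \<phi>1"
      unfolding I
      by (intro has_bochner_integral_integral_eq has_bochner_integral_add has_bochner_integral_mult_right hb)
    also have "\<dots> = 0"
      unfolding T1 T3 T5 using l by (simp add: field_simps)
    finally show ?thesis .
  qed
  obtain B where B: "\<forall>y\<in>range w. norm y \<le> B"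
    using bdd unfolding bounded_iff ..
  have "bounded (range (\<lambda>p. c + w (?\<xi> p)))"
    unfolding bounded_iff
  proof (intro exI [of _ "\<bar>c\<bar> + B"] ballI)
    fix y assume "y \<in> range (\<lambda>p. c + w (?\<xi> p))"
    then obtain p where p: "y = c + w (?\<xi> p)" by auto
    have "\<bar>w (?\<xi> p)\<bar> \<le> B" using B by simp
    then show "norm y \<le> \<bar>c\<bar> + B" unfolding p real_norm_def by linarith
  qed
  moreover have "continuous_on UNIV (\<lambda>p. c + w (?\<xi> p))"
    by (rule continuous_on_compose2 [OF cw]) (auto intro!: continuous_intros)
  moreover have "weak_dx (\<lambda>p. c + w (?\<xi> p)) (\<lambda>p. g (?\<xi> p))"
    unfolding weak_dx_def using by_parts by blast
  ultimately show ?thesis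
    unfolding rB_weak_solution_def using L2 main by blast
qed

section \<open>Smoothness of travelling profiles\<close>

text \<open>The derivative at a point depends only on the germ of the function, so on an open set
  the agreement passes to every iterated derivative.\<close>

lemma Ck_on_cong:
  assumes "open S" "\<And>p. p \<in> S \<Longrightarrow> f p = g p" "Ck_on k S f"
  shows "Ck_on k S g"
  using assms(2,3)
proof (induction k arbitrary: f g)
  case 0
  have "continuous_on S f \<longleftrightarrow> continuous_on S g"
    by (rule continuous_on_cong) (simp_all add: 0)
  then show ?case using 0 by simp
next
  case (Suc k)
  have der: "(g has_derivative frechet_derivative f (at p)) (at p)" if "p \<in> S" for p
  proof (rule has_derivative_transform_within_open [OF _ \<open>open S\<close> that])
    show "(f has_derivative frechet_derivative f (at p)) (at p)"
      using Suc.prems(2) that by (simp add: frechet_derivative_works)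
  qed (rule Suc.prems(1))
  then have eq: "frechet_derivative f (at p) = frechet_derivative g (at p)" if "p \<in> S" for p
    using that by (metis frechet_derivative_at)
  have "Ck_on k S (\<lambda>p. frechet_derivative g (at p) v)" for v
    by (rule Suc.IH [of "\<lambda>p. frechet_derivative f (at p) v"]) (use eq Suc.prems(2) in simp_all)
  then show ?case
    using der unfolding Ck_on.simps differentiable_def by blast
qed

lemma frechet_derivative_comp_linear_functional:
  fixes L :: "'a::real_normed_vector \<Rightarrow> real"
  assumes "bounded_linear L" and "(f has_real_derivative D) (at (L p))"
  shows "(\<lambda>p. f (L p)) differentiable (at p)"
    and "frechet_derivative (\<lambda>p. f (L p)) (at p) v = L v * D"
proof -
  have "((\<lambda>p. f (L p)) has_derivative (\<lambda>v. D * L v)) (at p)"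
    using has_derivative_compose [OF bounded_linear_imp_has_derivative [OF assms(1)]
        assms(2) [unfolded has_field_derivative_def]] .
  then show "(\<lambda>p. f (L p)) differentiable (at p)"
    and "frechet_derivative (\<lambda>p. f (L p)) (at p) v = L v * D"
    by (auto simp: differentiable_def frechet_derivative_at [symmetric])
qed

text \<open>The derivative of \<open>f (L p)\<close> in direction \<open>v\<close> is the scalar
  \<open>L v\<close> times \<open>f' (L p)\<close>, again of the same shape. A family closed under
  differentiation and scaling thus carries the induction on the order, without formulas for higher
  derivatives.\<close>

lemma smooth_on_comp_linear_functional:
  fixes L :: "'a::real_normed_vector \<Rightarrow> real"
  assumes L: "bounded_linear L" and "open T"
    and closed: "\<And>f. f \<in> \<A> \<Longrightarrow> \<exists>f'\<in>\<A>. \<forall>\<xi>\<in>T. (f has_real_derivative f' \<xi>) (at \<xi>)"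
    and scale: "\<And>f a. f \<in> \<A> \<Longrightarrow> (\<lambda>\<xi>. a * f \<xi>) \<in> \<A>"
    and "f \<in> \<A>"
  shows "smooth_on (L -` T) (\<lambda>p. f (L p))"
proof -
  have "open (L -` T)"
    by (rule open_vimage [OF \<open>open T\<close> linear_continuous_on [OF L]])
  have "Ck_on k (L -` T) (\<lambda>p. f (L p))" for k
    using \<open>f \<in> \<A>\<close>
  proof (induction k arbitrary: f)
    case 0
    obtain f' where f': "\<forall>\<xi>\<in>T. (f has_real_derivative f' \<xi>) (at \<xi>)"
      using closed [OF 0] by blast
    have "continuous_on T f"
      using f' by (intro continuous_at_imp_continuous_on ballI DERIV_isCont) blast
    then show ?case
      unfolding Ck_on.simps
      by (rule continuous_on_compose2) (auto intro: linear_continuous_on [OF L])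
  next
    case (Suc k)
    obtain f' where f': "f' \<in> \<A>" "\<forall>\<xi>\<in>T. (f has_real_derivative f' \<xi>) (at \<xi>)"
      using closed [OF Suc.prems] by blast
    have "Ck_on k (L -` T) (\<lambda>p. frechet_derivative (\<lambda>p. f (L p)) (at p) v)" for v
    proof (rule Ck_on_cong [OF \<open>open (L -` T)\<close>])
      show "Ck_on k (L -` T) (\<lambda>p. L v * f' (L p))"
        by (rule Suc.IH [OF scale [OF f'(1)]])
      show "L v * f' (L p) = frechet_derivative (\<lambda>p. f (L p)) (at p) v" if "p \<in> L -` T" for p
        using frechet_derivative_comp_linear_functional(2) [OF L, of f "f' (L p)" p v] f'(2) that by simp
    qed
    moreover have "(\<lambda>p. f (L p)) differentiable (at p)" if "p \<in> L -` T" for p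
      using frechet_derivative_comp_linear_functional(1) [OF L, of f "f' (L p)" p] f'(2) that by simp
    ultimately show ?case by simp
  qed
  then show ?thesis
    unfolding smooth_on_def by blast
qed

section \<open>The implicit profile\<close>

text \<open>The positive root of the first integral for \<open>0 < y < u0\<close>, in units where
  \<open>l = 1\<close>; it is the reciprocal of the integrand in the implicit relation.\<close>

definition profile_slope :: "real \<Rightarrow> real \<Rightarrow> real"
  where "profile_slope u0 y = (u0 - y) * sqrt ((2 * u0 + y) / (3 * y))"

lemma profile_slope_square:
  assumes "0 < y" "0 < u0"
  shows "(profile_slope u0 y)\<^sup>2 = (y\<^sup>2 - 3 * u0\<^sup>2) / 3 + 2 * u0 ^ 3 / (3 * y)"
proof -
  have "(profile_slope u0 y)\<^sup>2 = (u0 - y)\<^sup>2 * ((2 * u0 + y) / (3 * y))"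
    using assms by (simp add: profile_slope_def power_mult_distrib)
  then show ?thesis
    using assms by (simp add: field_simps power2_eq_square power3_eq_cube)
qed

text \<open>This is half the derivative of the formula in \<open>profile_slope_square\<close>,
  divided by the slope. Keeping the slope as the denominator makes it cancel later in the chain
  rule.\<close>

lemma DERIV_profile_slope:
  assumes "0 < y" "y < u0"
  shows "(profile_slope u0 has_real_derivative
    (y / 3 - u0 ^ 3 / (3 * y\<^sup>2)) / profile_slope u0 y) (at y)"
proof -
  define A where "A = (2 * u0 + y) / (3 * y)"
  have A: "0 < A" using assms unfolding A_def by simp
  have dA: "((\<lambda>y. (2 * u0 + y) / (3 * y)) has_real_derivative - (2 * u0) / (3 * y\<^sup>2)) (at y)"
    using assms by (auto intro!: derivative_eq_intros simp: field_simps power2_eq_square)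
  have "((\<lambda>y. sqrt ((2 * u0 + y) / (3 * y))) has_real_derivative
      inverse (sqrt A) / 2 * (- (2 * u0) / (3 * y\<^sup>2))) (at y)"
    using DERIV_chain2 [OF DERIV_real_sqrt dA] A unfolding A_def by blast
  moreover have "((\<lambda>y. u0 - y) has_real_derivative - 1) (at y)"
    by (auto intro!: derivative_eq_intros)
  ultimately have "(profile_slope u0 has_real_derivative
      - 1 * sqrt A + inverse (sqrt A) / 2 * (- (2 * u0) / (3 * y\<^sup>2)) * (u0 - y)) (at y)"
    unfolding profile_slope_def [abs_def] A_def by (rule DERIV_mult [rotated])
  moreover have "- 1 * sqrt A + inverse (sqrt A) / 2 * (- (2 * u0) / (3 * y\<^sup>2)) * (u0 - y)
      = (y / 3 - u0 ^ 3 / (3 * y\<^sup>2)) / profile_slope u0 y"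
  proof -
    have s: "sqrt A * sqrt A = A" using A by simp
    \<comment> \<open>After multiplication by the slope, square roots occur only as
      \<open>s * s = A\<close> and \<open>i * s = 1\<close>, and the claim becomes rational.\<close>
    have "(- 1 * s + i / 2 * B * e) * (e * s) = - e * (s * s) + B / 2 * e\<^sup>2 * (i * s)" for s i B e :: real
      by (simp add: field_simps power2_eq_square)
    then have "(- 1 * sqrt A + inverse (sqrt A) / 2 * (- (2 * u0) / (3 * y\<^sup>2)) * (u0 - y)) * ((u0 - y) * sqrt A)
        = - (u0 - y) * (sqrt A * sqrt A) + (- (2 * u0) / (3 * y\<^sup>2)) / 2 * (u0 - y)\<^sup>2 * (inverse (sqrt A) * sqrt A)" .
    also have "\<dots> = - (u0 - y) * (sqrt A * sqrt A) - u0 * (u0 - y)\<^sup>2 / (3 * y\<^sup>2)"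
      using A by simp
    also have "\<dots> = y / 3 - u0 ^ 3 / (3 * y\<^sup>2)"
      unfolding s A_def using assms by (simp add: field_simps power2_eq_square power3_eq_cube)
    finally show ?thesis
      unfolding profile_slope_def A_def [symmetric] using A assms by (simp add: eq_divide_eq)
  qed
  ultimately show ?thesis by simp
qed

lemma filterlim_profile_slope_at_right_0:
  assumes "0 < u0"
  shows "filterlim (profile_slope u0) at_top (at_right 0)"
  using assms unfolding profile_slope_def [abs_def] by real_asymp

definition profile_integrand :: "real \<Rightarrow> real \<Rightarrow> real"
  where "profile_integrand u0 v = sqrt (3 * v / (2 * u0 + v)) * (1 / (u0 - v))"

definition profile_inverse :: "real \<Rightarrow> real \<Rightarrow> real"
  where "profile_inverse u0 y = integral {0..y} (profile_integrand u0)"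

lemma continuous_on_profile_integrand:
  assumes "0 < u0" "b < u0"
  shows "continuous_on {0..b} (profile_integrand u0)"
  unfolding profile_integrand_def [abs_def] using assms
  by (intro continuous_intros) auto

lemma profile_relation_iff:
  assumes "0 < u0"
  shows "profile_relation u0 z y \<longleftrightarrow> 0 \<le> y \<and> y < u0 \<and> profile_inverse u0 y = z"
proof -
  have "(profile_integrand u0 has_integral z) {0..y} \<longleftrightarrow> profile_inverse u0 y = z" if "y < u0"
    using integrable_continuous_real [OF continuous_on_profile_integrand [OF assms that]]
    unfolding profile_inverse_def by (metis has_integral_integral integral_unique)
  then show ?thesis
    unfolding profile_relation_def profile_integrand_def [abs_def] by blast
qed

lemma DERIV_profile_inverse:
  assumes "0 < y" "y < u0"
  shows "(profile_inverse u0 has_real_derivative inverse (profile_slope u0 y)) (at y)"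
proof -
  \<comment> \<open>The integrand is continuous only below \<open>u0\<close>; the midpoint leaves
    \<open>y\<close> in the interior of \<open>{0..b}\<close>, so that the derivative within this
    interval is the full one.\<close>
  define b where "b = (y + u0) / 2"
  have b: "y < b" "b < u0" "0 < u0" using assms unfolding b_def by auto
  have "(profile_inverse u0 has_real_derivative profile_integrand u0 y) (at y within {0..b})"
    unfolding profile_inverse_def [abs_def] using assms b
    by (intro integral_has_real_derivative continuous_on_profile_integrand) auto
  moreover have "at y within {0..b} = at y"
    using assms b by (intro at_within_interior) simp
  moreover have "profile_integrand u0 y = inverse (profile_slope u0 y)"
    unfolding profile_integrand_def profile_slope_def
    by (simp add: real_sqrt_divide field_simps)
  ultimately show ?thesis by simp
qed

lemma profile_slope_pos:
  assumes "0 < y" "y < u0"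
  shows "0 < profile_slope u0 y"
  using assms by (simp add: profile_slope_def)

lemma continuous_on_profile_inverse:
  assumes "0 < u0" "b < u0"
  shows "continuous_on {0..b} (profile_inverse u0)"
  unfolding profile_inverse_def [abs_def]
  by (intro indefinite_integral_continuous_1 integrable_continuous_real continuous_on_profile_integrand assms)

lemma profile_inverse_0: "profile_inverse u0 0 = 0"
  by (simp add: profile_inverse_def)

lemma profile_inverse_strict_mono:
  assumes "0 \<le> a" "a < b" "b < u0"
  shows "profile_inverse u0 a < profile_inverse u0 b"
proof (rule DERIV_pos_imp_increasing_open [OF \<open>a < b\<close>])
  show "\<exists>y. (profile_inverse u0 has_real_derivative y) (at x) \<and> 0 < y" if "a < x" "x < b" for x
    using DERIV_profile_inverse [of x u0] profile_slope_pos [of x u0] assms that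
    by (intro exI [of _ "inverse (profile_slope u0 x)"]) auto
  show "continuous_on {a..b} (profile_inverse u0)"
    by (rule continuous_on_subset [OF continuous_on_profile_inverse [of u0 b]]) (use assms in auto)
qed

text \<open>The integrand dominates \<open>1 / (u0 - v) - 1 / u0\<close>, whose integral diverges at \<open>u0\<close>.\<close>

lemma profile_inverse_lower_bound:
  assumes "0 \<le> y" "y < u0"
  shows "ln (u0 / (u0 - y)) - y / u0 \<le> profile_inverse u0 y"
proof (rule has_integral_le)
  have u0: "0 < u0" using assms by simp
  have "((\<lambda>v. - ln (u0 - v) - v / u0) has_real_derivative 1 / (u0 - x) - 1 / u0) (at x within {0..y})"
    if "x \<in> {0..y}" for x
    using that assms by (auto intro!: derivative_eq_intros simp: field_simps)
  then have "((\<lambda>v. 1 / (u0 - v) - 1 / u0) has_integral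
      ((- ln (u0 - y) - y / u0) - (- ln (u0 - 0) - 0 / u0))) {0..y}"
    using assms(1)
    by (intro fundamental_theorem_of_calculus) (simp_all add: has_real_derivative_iff_has_vector_derivative)
  then show "((\<lambda>v. 1 / (u0 - v) - 1 / u0) has_integral (ln (u0 / (u0 - y)) - y / u0)) {0..y}"
    using assms by (simp add: ln_div algebra_simps)
  show "(profile_integrand u0 has_integral profile_inverse u0 y) {0..y}"
    unfolding profile_inverse_def
    by (intro integrable_integral integrable_continuous_real continuous_on_profile_integrand u0 assms)
  fix v assume v: "v \<in> {0..y}"
  have "v * (2 * u0 + v) \<le> u0 * (2 * u0 + u0)"
    using v assms by (intro mult_mono) auto
  then have "v * (v * (2 * u0 + v)) \<le> v * (3 * u0\<^sup>2)"
    using v by (intro mult_left_mono) (auto simp: power2_eq_square)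
  then have "(v / u0)\<^sup>2 \<le> 3 * v / (2 * u0 + v)"
    using v u0 by (simp add: field_simps power2_eq_square)
  then have "v / u0 \<le> sqrt (3 * v / (2 * u0 + v))"
    by (rule real_le_rsqrt)
  then have "v / u0 * (1 / (u0 - v)) \<le> profile_integrand u0 v"
    unfolding profile_integrand_def using v assms by (intro mult_right_mono) auto
  moreover have "1 / (u0 - v) - 1 / u0 = v / u0 * (1 / (u0 - v))"
    using v assms by (simp add: field_simps)
  ultimately show "1 / (u0 - v) - 1 / u0 \<le> profile_integrand u0 v"
    by simp
qed

lemma profile_inverse_surj:
  assumes "0 < u0" "0 \<le> z"
  shows "\<exists>y. 0 \<le> y \<and> y < u0 \<and> profile_inverse u0 y = z"
proof -
  \<comment> \<open>Chosen so that the logarithm in the lower bound equals \<open>z + 1\<close>; the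
    subtracted term \<open>b / u0\<close> is at most 1.\<close>
  define b where "b = u0 - u0 * exp (- (z + 1))"
  have b: "0 \<le> b" "b < u0"
    using assms unfolding b_def by auto
  have "ln (u0 / (u0 - b)) = z + 1"
    using assms unfolding b_def by (simp add: ln_div)
  moreover have "b / u0 \<le> 1" using b assms by simp
  ultimately have "z \<le> profile_inverse u0 b"
    using profile_inverse_lower_bound [OF b] by simp
  then obtain y where "0 \<le> y" "y \<le> b" "profile_inverse u0 y = z"
    using IVT' [of "profile_inverse u0" 0 z b] continuous_on_profile_inverse [OF assms(1) b(2)]
      assms b by (auto simp: profile_inverse_0)
  then show ?thesis using b by force
qed

text \<open>Surjectivity and strict monotonicity of \<open>profile_inverse\<close> make the choice
  unique for \<open>z \<ge> 0\<close>. For negative \<open>z\<close> no \<open>y\<close> qualifies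
  and the value is unspecified.\<close>

definition profile :: "real \<Rightarrow> real \<Rightarrow> real"
  where "profile u0 z = (THE y. profile_relation u0 z y)"

lemma profile_relation_iff_eq_profile:
  assumes "0 < u0" "0 \<le> z"
  shows "profile_relation u0 z y \<longleftrightarrow> y = profile u0 z"
proof -
  have "\<exists>!y. profile_relation u0 z y"
    unfolding profile_relation_iff [OF assms(1)]
    using profile_inverse_surj [OF assms] profile_inverse_strict_mono
    by (metis less_irrefl linorder_neqE_linordered_idom)
  then show ?thesis
    unfolding profile_def by (metis theI')
qed

text \<open>The shock layer is \<open>c\<close> minus this function of \<open>(x - c t) / l\<close>;
  the odd extension joins both sides of the shock in a single increasing function.\<close>

definition odd_profile :: "real \<Rightarrow> real \<Rightarrow> real"
  where "odd_profile u0 \<xi> = profile u0 \<bar>\<xi>\<bar> * sgn \<xi>"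

section \<open>Monotonicity, continuity, limits and derivative of the profile\<close>

context
  fixes u0 :: real
  assumes u0: "0 < u0"
begin

lemma profile_nonneg: "0 \<le> z \<Longrightarrow> 0 \<le> profile u0 z"
  and profile_less: "0 \<le> z \<Longrightarrow> profile u0 z < u0"
  and profile_inverse_profile: "0 \<le> z \<Longrightarrow> profile_inverse u0 (profile u0 z) = z"
  using profile_relation_iff_eq_profile [OF u0, of z "profile u0 z"]
  by (simp_all add: profile_relation_iff [OF u0])

lemma profile_inverse_nonneg: "0 \<le> y \<Longrightarrow> y < u0 \<Longrightarrow> 0 \<le> profile_inverse u0 y"
  using profile_inverse_strict_mono [of 0 y u0] by (cases "y = 0") (auto simp: profile_inverse_0)

lemma profile_profile_inverse: "0 \<le> y \<Longrightarrow> y < u0 \<Longrightarrow> profile u0 (profile_inverse u0 y) = y"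
  using profile_relation_iff_eq_profile [OF u0 profile_inverse_nonneg, of y y]
  by (simp add: profile_relation_iff [OF u0])

lemma profile_0: "profile u0 0 = 0"
  using profile_profile_inverse [of 0] u0 by (simp add: profile_inverse_0)

lemma profile_strict_mono:
  assumes "0 \<le> x" "x < y"
  shows "profile u0 x < profile u0 y"
proof (rule ccontr)
  assume "\<not> profile u0 x < profile u0 y"
  then have "profile_inverse u0 (profile u0 y) \<le> profile_inverse u0 (profile u0 x)"
    using profile_inverse_strict_mono [of "profile u0 y" "profile u0 x" u0] profile_nonneg [of y]
      profile_less [of x] assms by (cases "profile u0 x = profile u0 y") auto
  then show False using profile_inverse_profile [of x] profile_inverse_profile [of y] assms by simp
qed

lemma profile_pos: "0 < z \<Longrightarrow> 0 < profile u0 z"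
  using profile_strict_mono [of 0 z] by (simp add: profile_0)

lemma odd_profile_minus: "odd_profile u0 (- \<xi>) = - odd_profile u0 \<xi>"
  by (simp add: odd_profile_def sgn_minus)

lemma odd_profile_nonneg_eq: "0 \<le> \<xi> \<Longrightarrow> odd_profile u0 \<xi> = profile u0 \<xi>"
  by (cases "\<xi> = 0") (auto simp: odd_profile_def profile_0)

lemma abs_odd_profile: "\<bar>odd_profile u0 \<xi>\<bar> = profile u0 \<bar>\<xi>\<bar>"
  using profile_nonneg [of "\<bar>\<xi>\<bar>"] by (auto simp: odd_profile_def abs_mult sgn_if profile_0)

lemma strict_mono_odd_profile: "strict_mono (odd_profile u0)"
proof (rule strict_monoI)
  fix x y :: real assume xy: "x < y"
  consider "0 \<le> x" | "y \<le> 0" | "x < 0" "0 < y" using xy by linarith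
  then show "odd_profile u0 x < odd_profile u0 y"
  proof cases
    case 1 then show ?thesis using xy profile_strict_mono [of x y] by (simp add: odd_profile_nonneg_eq)
  next
    case 2 then show ?thesis using xy profile_strict_mono [of "-y" "-x"]
        odd_profile_minus [of x] odd_profile_minus [of y] odd_profile_nonneg_eq [of "-x"] odd_profile_nonneg_eq [of "-y"]
      by simp
  next
    case 3 then show ?thesis using profile_pos [of y] profile_pos [of "-x"]
        odd_profile_minus [of x] odd_profile_nonneg_eq [of "-x"] odd_profile_nonneg_eq [of y]
      by simp
  qed
qed

lemma range_odd_profile: "range (odd_profile u0) = {-u0<..<u0}"
proof
  show "range (odd_profile u0) \<subseteq> {-u0<..<u0}"
  proof
    fix y assume "y \<in> range (odd_profile u0)"
    then obtain \<xi> where "y = odd_profile u0 \<xi>" ..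
    then have "\<bar>y\<bar> < u0" using abs_odd_profile [of \<xi>] profile_less [of "\<bar>\<xi>\<bar>"] by simp
    then show "y \<in> {-u0<..<u0}" by auto
  qed
  show "{-u0<..<u0} \<subseteq> range (odd_profile u0)"
  proof
    fix y assume y: "y \<in> {-u0<..<u0}"
    show "y \<in> range (odd_profile u0)"
    proof (cases "0 \<le> y")
      case True
      then have "odd_profile u0 (profile_inverse u0 y) = y"
        using y by (simp add: odd_profile_nonneg_eq profile_inverse_nonneg profile_profile_inverse)
      then show ?thesis by (metis rangeI)
    next
      case False
      then have "odd_profile u0 (- profile_inverse u0 (- y)) = y"
        using y by (simp add: odd_profile_minus odd_profile_nonneg_eq profile_inverse_nonneg profile_profile_inverse)
      then show ?thesis by (metis rangeI)
    qed
  qed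
qed

text \<open>A monotone function with open range cannot jump. This also settles continuity at 0,
  where differentiability fails.\<close>

lemma continuous_on_odd_profile: "continuous_on UNIV (odd_profile u0)"
  using strict_mono_mono [OF strict_mono_odd_profile]
  by (intro continuous_onI_mono) (auto simp: range_odd_profile mono_def)

text \<open>By monotonicity the limit is the supremum of the range.\<close>

lemma odd_profile_tendsto_at_top: "(odd_profile u0 \<longlongrightarrow> u0) at_top"
proof (rule order_tendstoI)
  fix a assume "a < u0"
  then obtain y where y: "a < y" "y \<in> {-u0<..<u0}"
    using dense [of "max a (-u0)" u0] u0 by auto
  then obtain \<xi>0 where \<xi>0: "y = odd_profile u0 \<xi>0"
    unfolding range_odd_profile [symmetric] by blast
  have "a < odd_profile u0 \<xi>" if "\<xi>0 < \<xi>" for \<xi>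
    using strict_monoD [OF strict_mono_odd_profile that] y(1) \<xi>0 by simp
  then show "\<forall>\<^sub>F \<xi> in at_top. a < odd_profile u0 \<xi>"
    using eventually_gt_at_top [of \<xi>0] by (rule eventually_mono [rotated])
next
  fix a assume "u0 < a"
  then have "odd_profile u0 \<xi> < a" for \<xi>
    using range_odd_profile by (metis greaterThanLessThan_iff less_trans rangeI)
  then show "\<forall>\<^sub>F \<xi> in at_top. odd_profile u0 \<xi> < a" by simp
qed

lemma odd_profile_tendsto_at_bot: "(odd_profile u0 \<longlongrightarrow> - u0) at_bot"
proof -
  have "((\<lambda>\<xi>. - odd_profile u0 (- \<xi>)) \<longlongrightarrow> - u0) at_bot"
    by (intro tendsto_minus filterlim_compose [OF odd_profile_tendsto_at_top] filterlim_uminus_at_top_at_bot)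
  then show ?thesis by (simp add: odd_profile_minus)
qed

lemma DERIV_profile:
  assumes "0 < z"
  shows "(profile u0 has_real_derivative profile_slope u0 (profile u0 z)) (at z)"
proof -
  have y: "0 < profile u0 z" "profile u0 z < u0"
    using assms profile_pos profile_less by auto
  have "(profile u0 has_real_derivative inverse (inverse (profile_slope u0 (profile u0 z)))) (at z)"
  proof (rule DERIV_inverse_function [where a = 0 and b = "z + 1"])
    show "(profile_inverse u0 has_real_derivative inverse (profile_slope u0 (profile u0 z))) (at (profile u0 z))"
      by (rule DERIV_profile_inverse [OF y])
    show "inverse (profile_slope u0 (profile u0 z)) \<noteq> 0"
      using profile_slope_pos [OF y] by simp
    \<comment> \<open>Continuity, required by the inverse function rule, is taken over from the odd
      extension, which agrees with \<open>profile u0\<close> on the positive half line.\<close>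
    have "continuous_on {0<..} (odd_profile u0)"
      by (rule continuous_on_subset [OF continuous_on_odd_profile]) simp
    then have "continuous_on {0<..} (profile u0)"
      by (rule continuous_on_eq) (simp add: odd_profile_nonneg_eq)
    then show "isCont (profile u0) z"
      using assms by (simp add: continuous_on_eq_continuous_at)
  qed (use assms profile_inverse_profile in auto)
  then show ?thesis by simp
qed

end

lemma DERIV_sgn_real: "(x::real) \<noteq> 0 \<Longrightarrow> (sgn has_real_derivative 0) (at x)"
proof (cases "0 < x")
  case True
  show ?thesis
    by (rule has_field_derivative_transform_within_open [OF DERIV_const [of 1], of "{0<..}"])
      (use True in auto)
next
  case False
  assume "x \<noteq> 0"
  then show ?thesis
    by (intro has_field_derivative_transform_within_open [OF DERIV_const [of "-1"], of "{..<0}"])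
      (use False in auto)
qed

section \<open>The differential equation of the profile\<close>

text \<open>By the ODE, the second derivative of the profile is rational in the profile, so the following
  algebra is closed under differentiation away from \<open>0\<close>.\<close>

inductive_set profile_algebra :: "real \<Rightarrow> (real \<Rightarrow> real) set" for u0 :: real where
  const: "(\<lambda>_. a) \<in> profile_algebra u0"
| psi: "odd_profile u0 \<in> profile_algebra u0"
| inverse_psi: "(\<lambda>\<xi>. inverse (odd_profile u0 \<xi>)) \<in> profile_algebra u0"
| slope: "(\<lambda>\<xi>. profile_slope u0 \<bar>odd_profile u0 \<xi>\<bar>) \<in> profile_algebra u0"
| sgn: "sgn \<in> profile_algebra u0"
| add: "f \<in> profile_algebra u0 \<Longrightarrow> h \<in> profile_algebra u0 \<Longrightarrow> (\<lambda>\<xi>. f \<xi> + h \<xi>) \<in> profile_algebra u0"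
| mult: "f \<in> profile_algebra u0 \<Longrightarrow> h \<in> profile_algebra u0 \<Longrightarrow> (\<lambda>\<xi>. f \<xi> * h \<xi>) \<in> profile_algebra u0"

context
  fixes u0 :: real
  assumes u0: "0 < u0"
begin

private abbreviation "\<psi> \<equiv> odd_profile u0"
private abbreviation "\<sigma> \<equiv> \<lambda>\<xi>. profile_slope u0 \<bar>\<psi> \<xi>\<bar>"

lemma abs_odd_profile_pos_less:
  assumes "\<xi> \<noteq> 0"
  shows "0 < \<bar>\<psi> \<xi>\<bar>" "\<bar>\<psi> \<xi>\<bar> < u0"
  using assms profile_pos [OF u0, of "\<bar>\<xi>\<bar>"] profile_less [OF u0, of "\<bar>\<xi>\<bar>"]
  unfolding abs_odd_profile [OF u0] by auto

lemma DERIV_odd_profile: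
  assumes "\<xi> \<noteq> 0"
  shows "(\<psi> has_real_derivative \<sigma> \<xi>) (at \<xi>)"
proof (cases "0 < \<xi>")
  case True
  have "(\<psi> has_real_derivative profile_slope u0 (profile u0 \<xi>)) (at \<xi>)"
    by (rule has_field_derivative_transform_within_open [OF DERIV_profile [OF u0 True], of "{0<..}"])
      (use True odd_profile_nonneg_eq [OF u0] in auto)
  then show ?thesis using True by (simp add: abs_odd_profile [OF u0])
next
  case False
  then have "0 < - \<xi>" using assms by simp
  have "((\<lambda>\<xi>. - profile u0 (- \<xi>)) has_real_derivative profile_slope u0 (profile u0 (- \<xi>))) (at \<xi>)"
    using DERIV_minus [OF DERIV_chain2 [OF DERIV_profile [OF u0 \<open>0 < - \<xi>\<close>] DERIV_minus [OF DERIV_ident]]]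
    by simp
  then have "(\<psi> has_real_derivative profile_slope u0 (profile u0 (- \<xi>))) (at \<xi>)"
    by (rule has_field_derivative_transform_within_open [of _ _ _ "{..<0}"])
      (use \<open>0 < - \<xi>\<close> in \<open>auto simp: odd_profile_def\<close>)
  then show ?thesis using \<open>0 < - \<xi>\<close> by (simp add: abs_odd_profile [OF u0])
qed

lemma sgn_odd_profile: "sgn (\<psi> \<xi>) = sgn \<xi>"
  using abs_odd_profile_pos_less [of \<xi>] profile_nonneg [OF u0, of "\<bar>\<xi>\<bar>"]
  by (auto simp: odd_profile_def sgn_mult sgn_if profile_0 [OF u0] split: if_splits)

text \<open>The chain rule multiplies the derivative from \<open>DERIV_profile_slope\<close> by the
  derivative of \<open>\<psi>\<close>, which is the slope itself, so the slope cancels. The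
  resulting second derivative of \<open>\<psi>\<close> contains no square root.\<close>

lemma DERIV_odd_profile_slope:
  assumes "\<xi> \<noteq> 0"
  shows "(\<sigma> has_real_derivative \<psi> \<xi> / 3 - sgn \<xi> * u0 ^ 3 / (3 * (\<psi> \<xi>)\<^sup>2)) (at \<xi>)"
proof -
  note y = abs_odd_profile_pos_less [OF assms]
  have "((\<lambda>\<xi>. sgn \<xi> * \<psi> \<xi>) has_real_derivative 0 * \<psi> \<xi> + \<sigma> \<xi> * sgn \<xi>) (at \<xi>)"
    by (rule DERIV_mult [OF DERIV_sgn_real [OF assms] DERIV_odd_profile [OF assms]])
  moreover have "(\<lambda>\<xi>. sgn \<xi> * \<psi> \<xi>) = (\<lambda>\<xi>. \<bar>\<psi> \<xi>\<bar>)"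
    using sgn_odd_profile by (metis abs_sgn mult.commute)
  ultimately have "((\<lambda>\<xi>. \<bar>\<psi> \<xi>\<bar>) has_real_derivative \<sigma> \<xi> * sgn \<xi>) (at \<xi>)"
    by simp
  then have "(\<sigma> has_real_derivative
      (\<bar>\<psi> \<xi>\<bar> / 3 - u0 ^ 3 / (3 * \<bar>\<psi> \<xi>\<bar>\<^sup>2)) / \<sigma> \<xi> * (\<sigma> \<xi> * sgn \<xi>)) (at \<xi>)"
    by (rule DERIV_chain2 [where g = "\<lambda>\<xi>. \<bar>\<psi> \<xi>\<bar>" and x = \<xi>, OF DERIV_profile_slope [OF y]])
  moreover have "(\<bar>\<psi> \<xi>\<bar> / 3 - u0 ^ 3 / (3 * \<bar>\<psi> \<xi>\<bar>\<^sup>2)) / \<sigma> \<xi> * (\<sigma> \<xi> * sgn \<xi>)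
      = \<bar>\<psi> \<xi>\<bar> * sgn \<xi> / 3 - sgn \<xi> * u0 ^ 3 / (3 * (\<psi> \<xi>)\<^sup>2)"
  proof -
    have cancel: "X / s * (s * q) = X * q" if "s \<noteq> 0" for X s q :: real
      using that by simp
    show ?thesis
      by (subst cancel) (use profile_slope_pos [OF y] in \<open>simp_all add: left_diff_distrib\<close>)
  qed
  moreover have "\<bar>\<psi> \<xi>\<bar> * sgn \<xi> = \<psi> \<xi>"
    using sgn_odd_profile [of \<xi>] by (metis abs_mult_sgn)
  ultimately show ?thesis by simp
qed

text \<open>The ODE of the profile in conservation form; the differentiated function stays continuous at the
  singular point.\<close>

lemma DERIV_odd_profile_mult_slope:
  assumes "\<xi> \<noteq> 0"
  shows "((\<lambda>\<xi>. \<psi> \<xi> * \<sigma> \<xi>) has_real_derivative 1/2 * (\<sigma> \<xi>)\<^sup>2 + ((\<psi> \<xi>)\<^sup>2 - u0\<^sup>2) / 2) (at \<xi>)"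
proof -
  note y = abs_odd_profile_pos_less [OF assms]
  have "((\<lambda>\<xi>. \<psi> \<xi> * \<sigma> \<xi>) has_real_derivative
      \<sigma> \<xi> * \<sigma> \<xi> + (\<psi> \<xi> / 3 - sgn \<xi> * u0 ^ 3 / (3 * (\<psi> \<xi>)\<^sup>2)) * \<psi> \<xi>) (at \<xi>)"
    by (rule DERIV_mult [OF DERIV_odd_profile [OF assms] DERIV_odd_profile_slope [OF assms]])
  moreover have "(a / 3 - s * k / (3 * a\<^sup>2)) * a = a\<^sup>2 / 3 - k * (a * s) / (3 * a\<^sup>2)" for a s k :: real
    by (simp add: left_diff_distrib power2_eq_square)
  then have "(\<psi> \<xi> / 3 - sgn \<xi> * u0 ^ 3 / (3 * (\<psi> \<xi>)\<^sup>2)) * \<psi> \<xi>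
      = (\<psi> \<xi>)\<^sup>2 / 3 - u0 ^ 3 * (\<psi> \<xi> * sgn \<xi>) / (3 * (\<psi> \<xi>)\<^sup>2)" .
  moreover have "\<psi> \<xi> * sgn \<xi> = \<bar>\<psi> \<xi>\<bar>"
    by (simp only: abs_sgn [of "\<psi> \<xi>"] sgn_odd_profile)
  moreover have "(\<psi> \<xi>)\<^sup>2 = \<bar>\<psi> \<xi>\<bar>\<^sup>2"
    by simp
  moreover have "k * a / (3 * a\<^sup>2) = k / (3 * a)" if "0 < a" for k a :: real
    using that by (simp add: power2_eq_square)
  then have "u0 ^ 3 * \<bar>\<psi> \<xi>\<bar> / (3 * \<bar>\<psi> \<xi>\<bar>\<^sup>2) = u0 ^ 3 / (3 * \<bar>\<psi> \<xi>\<bar>)"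
    using y(1) .
  \<comment> \<open>Half of \<open>profile_slope_square\<close> replaces one half of the squared
    slope; the singular terms \<open>u0 ^ 3 / (3 * \<bar>\<psi> \<xi>\<bar>)\<close> then
    cancel.\<close>
  moreover have "\<sigma> \<xi> * \<sigma> \<xi> + (\<bar>\<psi> \<xi>\<bar>\<^sup>2 / 3 - u0 ^ 3 / (3 * \<bar>\<psi> \<xi>\<bar>))
      = 1/2 * (\<sigma> \<xi>)\<^sup>2 + (\<bar>\<psi> \<xi>\<bar>\<^sup>2 - u0\<^sup>2) / 2"
    using profile_slope_square [OF y(1) u0] unfolding power2_eq_square [of "\<sigma> \<xi>"]
    by (simp add: field_simps)
  ultimately show ?thesis by (simp only:)
qed

text \<open>The formula for \<open>s * profile_slope u0 \<bar>s\<bar>\<close> uses that \<open>sqrt\<close> is an odd function on all reals.\<close>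

lemma continuous_on_odd_profile_mult_slope: "continuous_on UNIV (\<lambda>\<xi>. \<psi> \<xi> * \<sigma> \<xi>)"
proof -
  have "s * profile_slope u0 \<bar>s\<bar> = (u0 - \<bar>s\<bar>) * sqrt (s * (2 * u0 + \<bar>s\<bar>) / 3)" for s
  proof -
    have *: "s * sqrt (X / (3 * s)) = sqrt (s * X / 3)" if "0 < s" for s X :: real
    proof -
      have "s * sqrt (X / (3 * s)) = sqrt (s\<^sup>2 * (X / (3 * s)))"
        using that by (simp only: real_sqrt_mult real_sqrt_pow2_iff) simp
      also have "s\<^sup>2 * (X / (3 * s)) = s * X / 3"
        using that by (simp add: power2_eq_square)
      finally show ?thesis .
    qed
    consider "s = 0" | "0 < s" | "s < 0" by linarith
    then show ?thesis
    proof cases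
      case 2 then show ?thesis using * [of s "2 * u0 + s"] by (simp add: profile_slope_def)
    next
      case 3
      have "s * profile_slope u0 \<bar>s\<bar> = - ((u0 + s) * (- s * sqrt ((2 * u0 - s) / (3 * - s))))"
        using 3 by (simp add: profile_slope_def)
      also have "\<dots> = (u0 + s) * - sqrt (- s * (2 * u0 - s) / 3)"
        using * [of "-s" "2 * u0 - s"] 3 by simp
      also have "\<dots> = (u0 - \<bar>s\<bar>) * sqrt (s * (2 * u0 + \<bar>s\<bar>) / 3)"
        using 3 by (simp only: real_sqrt_minus [symmetric]) simp
      finally show ?thesis .
    qed simp
  qed
  then show ?thesis
    by (simp only:) (intro continuous_intros continuous_on_odd_profile u0, simp)
qed

lemma profile_algebra_closed_DERIV:
  assumes "f \<in> profile_algebra u0"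
  shows "\<exists>f'\<in>profile_algebra u0. \<forall>\<xi>\<in>-{0}. (f has_real_derivative f' \<xi>) (at \<xi>)"
  using assms
proof induction
  case (const a)
  show ?case
    by (rule bexI [OF _ profile_algebra.const [of 0]]) simp
next
  case psi
  show ?case
    by (rule bexI [OF _ profile_algebra.slope]) (simp add: DERIV_odd_profile)
next
  case inverse_psi
  have "((\<lambda>\<xi>. inverse (\<psi> \<xi>)) has_real_derivative - 1 * (\<sigma> \<xi> * (inverse (\<psi> \<xi>) * inverse (\<psi> \<xi>)))) (at \<xi>)"
    if "\<xi> \<in> -{0}" for \<xi>
  proof -
    have "\<xi> \<noteq> 0" using that by simp
    then have "\<psi> \<xi> \<noteq> 0" using abs_odd_profile_pos_less(1) by fastforce
    have "- (\<sigma> \<xi> * inverse ((\<psi> \<xi>)\<^sup>2)) = - 1 * (\<sigma> \<xi> * (inverse (\<psi> \<xi>) * inverse (\<psi> \<xi>)))"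
      by (simp add: power2_eq_square)
    then show ?thesis
      using DERIV_inverse_fun [OF DERIV_odd_profile [OF \<open>\<xi> \<noteq> 0\<close>] \<open>\<psi> \<xi> \<noteq> 0\<close>]
      by (simp only: numeral_2_eq_2)
  qed
  then show ?case
    by (intro bexI [OF ballI profile_algebra.mult [OF profile_algebra.const profile_algebra.mult
          [OF profile_algebra.slope profile_algebra.mult [OF profile_algebra.inverse_psi profile_algebra.inverse_psi]]]])
next
  \<comment> \<open>This case is the reason for having \<open>sgn\<close> and the inverse of
    \<open>\<psi>\<close> among the generators.\<close>
  case slope
  have "(\<sigma> has_real_derivative
      1/3 * \<psi> \<xi> + - (u0 ^ 3 / 3) * (sgn \<xi> * (inverse (\<psi> \<xi>) * inverse (\<psi> \<xi>)))) (at \<xi>)"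
    if "\<xi> \<in> -{0}" for \<xi>
  proof -
    have "\<xi> \<noteq> 0" using that by simp
    have "\<psi> \<xi> / 3 - sgn \<xi> * u0 ^ 3 / (3 * (\<psi> \<xi>)\<^sup>2)
        = 1/3 * \<psi> \<xi> + - (u0 ^ 3 / 3) * (sgn \<xi> * (inverse (\<psi> \<xi>) * inverse (\<psi> \<xi>)))"
      using abs_odd_profile_pos_less(1) [OF \<open>\<xi> \<noteq> 0\<close>] by (simp add: field_simps power2_eq_square)
    then show ?thesis using DERIV_odd_profile_slope [OF \<open>\<xi> \<noteq> 0\<close>] by (simp only:)
  qed
  then show ?case
    by (intro bexI [OF ballI profile_algebra.add [OF profile_algebra.mult [OF profile_algebra.const profile_algebra.psi]
          profile_algebra.mult [OF profile_algebra.const profile_algebra.mult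
            [OF profile_algebra.sgn profile_algebra.mult [OF profile_algebra.inverse_psi profile_algebra.inverse_psi]]]]])
next
  case sgn
  show ?case
    by (rule bexI [OF _ profile_algebra.const [of 0]]) (simp add: DERIV_sgn_real)
next
  case (add f h)
  then obtain f' h' where f': "f' \<in> profile_algebra u0" "\<forall>\<xi>\<in>-{0}. (f has_real_derivative f' \<xi>) (at \<xi>)"
    and h': "h' \<in> profile_algebra u0" "\<forall>\<xi>\<in>-{0}. (h has_real_derivative h' \<xi>) (at \<xi>)"
    by blast
  show ?case
    by (rule bexI [OF _ profile_algebra.add [OF f'(1) h'(1)]]) (simp add: DERIV_add f'(2) h'(2))
next
  case (mult f h)
  then obtain f' h' where f': "f' \<in> profile_algebra u0" "\<forall>\<xi>\<in>-{0}. (f has_real_derivative f' \<xi>) (at \<xi>)"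
    and h': "h' \<in> profile_algebra u0" "\<forall>\<xi>\<in>-{0}. (h has_real_derivative h' \<xi>) (at \<xi>)"
    by blast
  show ?case
    by (rule bexI [OF _ profile_algebra.add [OF profile_algebra.mult [OF f'(1) mult.hyps(2)]
          profile_algebra.mult [OF h'(1) mult.hyps(1)]]]) (simp add: DERIV_mult f'(2) h'(2))
qed

end

theorem proposition6p2:
  fixes l um up c u0 :: real
  assumes "0 < l" and "up < um"
    and "c = 1/2 * (um + up)" and "u0 = 1/2 * (um - up)"
  shows "burgers_entropy_solution (simple_shock um up c) \<and>
    (\<exists>\<eta> :: real \<Rightarrow> real. \<exists>u :: real \<times> real \<Rightarrow> real.
      (\<forall>z\<ge>0. \<forall>y. profile_relation u0 z y \<longleftrightarrow> y = \<eta> z) \<and>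
      (\<forall>x t. u (x, t) = c - \<eta> (\<bar>x - c * t\<bar> / l) * sgn (x - c * t)) \<and>
      rB_weak_solution l u \<and>
      weakly_singular_shock_layer c u \<and>
      (\<forall>t. ((\<lambda>x. u (x, t)) \<longlongrightarrow> um) at_bot) \<and>
      (\<forall>t. ((\<lambda>x. u (x, t)) \<longlongrightarrow> up) at_top))"
proof -
  note l = \<open>0 < l\<close>
  have u0: "0 < u0" and um: "um = c + u0" and up: "up = c - u0"
    using assms by (simp_all add: field_simps)
  let ?\<psi> = "odd_profile u0"
  let ?\<sigma> = "\<lambda>\<xi>. profile_slope u0 \<bar>?\<psi> \<xi>\<bar>"
  define L where "L = (\<lambda>p::real \<times> real. (fst p - c * snd p) / l)"
  define u where "u = (\<lambda>p. c - ?\<psi> (L p))"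
  have L: "bounded_linear L"
    unfolding L_def
    by (intro bounded_linear_divide [THEN bounded_linear_compose] bounded_linear_sub bounded_linear_fst
        bounded_linear_const_mult bounded_linear_snd)
  have L_eq: "L (x, t) = (x - c * t) / l" for x t
    by (simp add: L_def)
  have cont_L: "continuous_on S L" for S
    by (rule linear_continuous_on [OF L])
  have u_eq: "u (x, t) = c - profile u0 (\<bar>x - c * t\<bar> / l) * sgn (x - c * t)" for x t
    using l by (simp add: u_def L_eq odd_profile_def sgn_divide)
  have cont_\<psi>: "continuous_on UNIV ?\<psi>"
    by (rule continuous_on_odd_profile [OF u0])
  have cont_scale: "continuous_on UNIV (\<lambda>\<xi>. h (\<xi> / l))" if "continuous_on UNIV h" for h :: "real \<Rightarrow> real"
    by (rule continuous_on_compose2 [OF that]) (use l in \<open>auto intro!: continuous_intros\<close>)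
  have DERIV_scale: "((\<lambda>\<xi>. h (\<xi> / l)) has_real_derivative D / l) (at \<xi>)"
    if "(h has_real_derivative D) (at (\<xi> / l))" for h D \<xi>
    using DERIV_chain2 [OF that DERIV_cdivide [OF DERIV_ident]] by simp
  have bdd: "\<bar>?\<psi> \<xi>\<bar> < u0" for \<xi>
    using abs_odd_profile [OF u0, of \<xi>] profile_less [OF u0, of "\<bar>\<xi>\<bar>"] by simp
  have cont_u: "continuous_on UNIV u"
    unfolding u_def
    by (intro continuous_on_diff continuous_on_const continuous_on_compose2 [OF cont_\<psi> cont_L]) simp

  have "rB_weak_solution l (\<lambda>p. c + - ?\<psi> ((fst p - c * snd p) / l))"
  \<comment> \<open>Dividing the ODE for \<open>l = 1\<close> by \<open>l^2\<close> scales its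
    constant \<open>u0^2 / 2\<close> to this \<open>K\<close>. At 0 the formula for \<open>g\<close>
    divides by zero and yields 0; elsewhere \<open>g\<close> is the classical derivative. The ODE is
    invariant under changing the signs of \<open>w\<close> and \<open>g\<close>, so the decreasing
    wave satisfies it like \<open>\<psi>\<close>.\<close>
  proof (rule rB_weak_solution_travelling [where g = "\<lambda>\<xi>. - (?\<sigma> (\<xi> / l) / l)" and K = "u0\<^sup>2 / (2 * l\<^sup>2)"])
    show "l \<noteq> 0" using l by simp
    show "continuous_on UNIV (\<lambda>\<xi>. - ?\<psi> (\<xi> / l))"
      by (intro continuous_on_minus cont_scale cont_\<psi>)
    have "norm y \<le> u0" if "y \<in> range (\<lambda>\<xi>. - ?\<psi> (\<xi> / l))" for y
    proof -
      obtain \<xi> where "y = - ?\<psi> (\<xi> / l)" using \<open>y \<in> _\<close> ..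
      then show ?thesis using bdd [of "\<xi> / l"] by simp
    qed
    then show "bounded (range (\<lambda>\<xi>. - ?\<psi> (\<xi> / l)))"
      unfolding bounded_iff by blast
    show "((\<lambda>\<xi>. - ?\<psi> (\<xi> / l)) has_real_derivative - (?\<sigma> (\<xi> / l) / l)) (at \<xi>)" if "\<xi> \<noteq> 0" for \<xi>
      by (intro DERIV_minus DERIV_scale DERIV_odd_profile [OF u0]) (use that l in simp)
    have "isCont (\<lambda>\<xi>. ?\<sigma> (\<xi> / l)) \<xi>" if "\<xi> \<noteq> 0" for \<xi>
      by (rule DERIV_isCont, rule DERIV_scale [where h = ?\<sigma>], rule DERIV_odd_profile_slope [OF u0])
        (use that l in simp)
    then have "continuous_on (- {0}) (\<lambda>\<xi>. ?\<sigma> (\<xi> / l))"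
      by (intro continuous_at_imp_continuous_on) simp
    then have "(\<lambda>\<xi>. ?\<sigma> (\<xi> / l)) \<in> borel_measurable borel"
      by (intro borel_measurable_continuous_countable_exceptions [of "{0}"]) simp_all
    then show "(\<lambda>\<xi>. - (?\<sigma> (\<xi> / l) / l)) \<in> borel_measurable borel"
      by simp
    have eq: "- ?\<psi> (\<xi> / l) * - (?\<sigma> (\<xi> / l) / l) = ?\<psi> (\<xi> / l) * ?\<sigma> (\<xi> / l) / l" for \<xi>
      by simp
    show "continuous_on UNIV (\<lambda>\<xi>. - ?\<psi> (\<xi> / l) * - (?\<sigma> (\<xi> / l) / l))"
      unfolding eq using l
      by (intro continuous_on_divide continuous_on_const cont_scale [OF continuous_on_odd_profile_mult_slope [OF u0]]) simp
    show "((\<lambda>\<xi>. - ?\<psi> (\<xi> / l) * - (?\<sigma> (\<xi> / l) / l)) has_real_derivative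
        1/2 * (- (?\<sigma> (\<xi> / l) / l))\<^sup>2 + ((- ?\<psi> (\<xi> / l))\<^sup>2 / (2 * l\<^sup>2) - u0\<^sup>2 / (2 * l\<^sup>2))) (at \<xi>)"
      if "\<xi> \<noteq> 0" for \<xi>
    proof -
      have "((\<lambda>\<xi>. ?\<psi> (\<xi> / l) * ?\<sigma> (\<xi> / l) / l) has_real_derivative
          (1/2 * (?\<sigma> (\<xi> / l))\<^sup>2 + ((?\<psi> (\<xi> / l))\<^sup>2 - u0\<^sup>2) / 2) / l / l) (at \<xi>)"
        by (intro DERIV_cdivide DERIV_scale [OF DERIV_odd_profile_mult_slope [OF u0]]) (use that l in simp)
      moreover have "(1/2 * s\<^sup>2 + (r\<^sup>2 - u0\<^sup>2) / 2) / l / l = 1/2 * (- (s / l))\<^sup>2 + ((- r)\<^sup>2 / (2 * l\<^sup>2) - u0\<^sup>2 / (2 * l\<^sup>2))"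
        for r s using l by (simp add: field_simps power2_eq_square)
      ultimately show ?thesis
        unfolding eq by (simp only:)
    qed
  qed
  then have rB: "rB_weak_solution l u"
    by (simp add: u_def L_def)

  \<comment> \<open>The difference is written with \<open>+\<close> and \<open>*\<close> to match
    the closure rules of \<open>profile_algebra\<close>.\<close>
  have "smooth_on (L -` (- {0})) (\<lambda>p. c + - 1 * ?\<psi> (L p))"
  proof (rule smooth_on_comp_linear_functional [OF L _ profile_algebra_closed_DERIV [OF u0]])
    show "(\<lambda>\<xi>. c + - 1 * ?\<psi> \<xi>) \<in> profile_algebra u0"
      by (intro profile_algebra.add [OF profile_algebra.const profile_algebra.mult [OF profile_algebra.const profile_algebra.psi]])
    show "(\<lambda>\<xi>. a * f \<xi>) \<in> profile_algebra u0" if "f \<in> profile_algebra u0" for f a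
      by (intro profile_algebra.mult [OF profile_algebra.const that])
  qed (rule open_Compl closed_singleton)+
  moreover have "L -` (- {0}) = {(x, t). x \<noteq> c * t}"
    using l by (auto simp: L_def)
  ultimately have smooth: "smooth_on {(x, t). x \<noteq> c * t} u"
    by (simp add: u_def)

  have dx_u: "dx u (x, t) = - ?\<sigma> ((x - c * t) / l) / l" if "x \<noteq> c * t" for x t
  proof -
    have "((\<lambda>\<xi>. c - ?\<psi> \<xi>) has_real_derivative 0 - ?\<sigma> (L (x, t))) (at (L (x, t)))"
      by (intro DERIV_diff DERIV_const DERIV_odd_profile [OF u0]) (use that l in \<open>simp add: L_eq\<close>)
    from frechet_derivative_comp_linear_functional(2) [OF L this, of "(1, 0)"]
    show ?thesis by (simp add: dx_def u_def L_eq)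
  qed
  have singular: "filterlim (\<lambda>x. \<bar>dx u (x, t)\<bar>) at_top (at (c * t))" for t
  proof -
    have "isCont ?\<psi> 0" using cont_\<psi> by (simp add: continuous_on_eq_continuous_at)
    then have "((\<lambda>x. ?\<psi> ((x - c * t) / l)) \<longlongrightarrow> ?\<psi> 0) (at (c * t))"
      by (rule isCont_tendsto_compose) (use l in \<open>auto intro!: tendsto_eq_intros\<close>)
    then have "((\<lambda>x. \<bar>?\<psi> ((x - c * t) / l)\<bar>) \<longlongrightarrow> 0) (at (c * t))"
      using tendsto_rabs_zero by (simp add: odd_profile_def)
    \<comment> \<open>The slope tends to infinity for arguments approaching 0 from the right, so
      \<open>\<bar>?\<psi>\<bar>\<close> has to tend to 0 through positive values.\<close>
    moreover have "\<bar>?\<psi> ((x - c * t) / l)\<bar> \<in> {0<..}" if "x \<noteq> c * t" for x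
      using abs_odd_profile_pos_less(1) [OF u0, of "(x - c * t) / l"] that l by simp
    ultimately have "filterlim (\<lambda>x. \<bar>?\<psi> ((x - c * t) / l)\<bar>) (at_right 0) (at (c * t))"
      unfolding filterlim_at by (auto simp: eventually_at_filter)
    then have "filterlim (\<lambda>x. ?\<sigma> ((x - c * t) / l)) at_top (at (c * t))"
      by (rule filterlim_compose [OF filterlim_profile_slope_at_right_0 [OF u0]])
    then have lim: "filterlim (\<lambda>x. 1 / l * ?\<sigma> ((x - c * t) / l)) at_top (at (c * t))"
      by (rule filterlim_tendsto_pos_mult_at_top [OF tendsto_const, rotated]) (use l in simp)
    have "1 / l * ?\<sigma> ((x - c * t) / l) = \<bar>dx u (x, t)\<bar>" if "x \<noteq> c * t" for x
    proof -
      have "0 < ?\<sigma> ((x - c * t) / l)"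
        by (intro profile_slope_pos abs_odd_profile_pos_less [OF u0]) (use that l in simp_all)
      then show ?thesis using l dx_u [OF that] by simp
    qed
    then have ev: "\<forall>\<^sub>F x in at (c * t). 1 / l * ?\<sigma> ((x - c * t) / l) = \<bar>dx u (x, t)\<bar>"
      by (auto simp: eventually_at_filter)
    show ?thesis
      by (rule filterlim_cong [OF refl refl ev, THEN iffD1, OF lim])
  qed

  have "antimono (\<lambda>x. u (x, t))" for t
    using l strict_mono_mono [OF strict_mono_odd_profile [OF u0]]
    by (auto simp: antimono_def mono_def u_def L_eq divide_right_mono)
  moreover have "bounded (range u)"
    using rB by (simp add: rB_weak_solution_def)
  moreover have "\<exists>w. \<forall>x t. u (x, t) = w (x - c * t)"
    by (rule exI [of _ "\<lambda>\<xi>. c - ?\<psi> (\<xi> / l)"]) (simp add: u_def L_eq)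
  ultimately have layer: "weakly_singular_shock_layer c u"
    unfolding weakly_singular_shock_layer_def using cont_u smooth singular by blast

  have "LIM x at_bot. (x - c * t) / l :> at_bot" "LIM x at_top. (x - c * t) / l :> at_top" for t
    using l by real_asymp+
  then have "((\<lambda>x. u (x, t)) \<longlongrightarrow> c - - u0) at_bot" "((\<lambda>x. u (x, t)) \<longlongrightarrow> c - u0) at_top" for t
    unfolding u_def L_eq
    by (intro tendsto_diff tendsto_const filterlim_compose [OF odd_profile_tendsto_at_bot [OF u0]]
        filterlim_compose [OF odd_profile_tendsto_at_top [OF u0]]; simp)+
  then have limits: "((\<lambda>x. u (x, t)) \<longlongrightarrow> um) at_bot" "((\<lambda>x. u (x, t)) \<longlongrightarrow> up) at_top" for t
    by (simp_all add: um up)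

  have "burgers_entropy_solution (simple_shock um up c)"
    by (rule burgers_entropy_solution_simple_shock) (use assms in simp_all)
  moreover have "\<forall>z\<ge>0. \<forall>y. profile_relation u0 z y \<longleftrightarrow> y = profile u0 z"
    using profile_relation_iff_eq_profile [OF u0] by blast
  ultimately show ?thesis
    using u_eq rB layer limits by blast
qed

end
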